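(* Let $p$ be a prime and let $G$ be a finite $p$-group, of order at least $p^5$, in which $|G:G'| \le p^3$. Then all maximal subgroups of $G$, with at most one exception, have irreducible complex characters of degree $p$. If an exceptional maximal subgroup $H$ exists (that is, a maximal subgroup $H$ with no irreducible complex character of degree $p$), then all other maximal subgroups $M \neq H$ of $G$ satisfy $|M:M'| \le |G:G'|$.
   Context: $X'$ denotes the commutator subgroup of a group $X$. Characters are ordinary (complex) characters. *)

theory Defs
  imports
    "HOL-Computational_Algebra.Primes"
    "HOL-Algebra.Generated_Groups"
    "HOL-Algebra.Coset"
    "Jordan_Normal_Form.VS_Connect"
begin

definition finite_p_group :: "nat \<Rightarrow> ('a, 'b) monoid_scheme \<Rightarrow> bool" where
  "finite_p_group p G \<longleftrightarrow>
     group G \<and> finite (carrier G) \<and> (\<exists>k. Coset.order G = p ^ k)"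

definition maximal_subgroup :: "'a set \<Rightarrow> ('a, 'b) monoid_scheme \<Rightarrow> bool" where
  "maximal_subgroup M G \<longleftrightarrow>
     subgroup M G \<and> M \<noteq> carrier G \<and>
     (\<forall>K. subgroup K G \<longrightarrow> M \<subseteq> K \<longrightarrow> K = M \<or> K = carrier G)"

definition subgroup_index :: "('a, 'b) monoid_scheme \<Rightarrow> 'a set \<Rightarrow> nat" where
  "subgroup_index G H = card (rcosets\<^bsub>G\<^esub> H)"

abbreviation commutator_subgroup :: "('a, 'b) monoid_scheme \<Rightarrow> 'a set" where
  "commutator_subgroup G \<equiv> derived G (carrier G)"

abbreviation GL_complex :: "nat \<Rightarrow> complex mat monoid" where
  "GL_complex n \<equiv> units_of (ring_mat TYPE(complex) n ())"

definition representation ::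
  "('a, 'b) monoid_scheme \<Rightarrow> nat \<Rightarrow> ('a \<Rightarrow> complex mat) \<Rightarrow> bool" where
  "representation G n \<rho> \<longleftrightarrow> \<rho> \<in> hom G (GL_complex n)"

definition irreducible_representation ::
  "('a, 'b) monoid_scheme \<Rightarrow> nat \<Rightarrow> ('a \<Rightarrow> complex mat) \<Rightarrow> bool" where
  "irreducible_representation G n \<rho> \<longleftrightarrow>
     representation G n \<rho> \<and> 0 < n \<and>
     (\<forall>W. VectorSpace.subspace class_ring W (module_vec TYPE(complex) n) \<longrightarrow>
        (\<forall>g\<in>carrier G. \<forall>w\<in>W. \<rho> g *\<^sub>v w \<in> W) \<longrightarrow>
        W = {0\<^sub>v n} \<or> W = carrier_vec n)"

definition mat_trace :: "complex mat \<Rightarrow> complex" where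
  "mat_trace A = (\<Sum>i<dim_row A. A $$ (i, i))"

text \<open>Characters are extensional functions: they are undefined off the carrier, so that
  distinct elements of \<open>irr_characters G\<close> differ on \<open>G\<close>.\<close>

definition irr_characters :: "('a, 'b) monoid_scheme \<Rightarrow> ('a \<Rightarrow> complex) set" where
  "irr_characters G =
     {(\<lambda>g\<in>carrier G. mat_trace (\<rho> g)) | n \<rho>. irreducible_representation G n \<rho>}"

definition char_degree :: "('a, 'b) monoid_scheme \<Rightarrow> ('a \<Rightarrow> complex) \<Rightarrow> complex" where
  "char_degree G \<chi> = \<chi> \<one>\<^bsub>G\<^esub>"

definition has_irr_character_of_degree :: "('a, 'b) monoid_scheme \<Rightarrow> nat \<Rightarrow> bool" where
  "has_irr_character_of_degree G d \<longleftrightarrow>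
     (\<exists>\<chi>\<in>irr_characters G. char_degree G \<chi> = of_nat d)"

end

theory Submission
  imports Defs "HOL-Algebra.Multiplicative_Group" "HOL-Algebra.Group_Action" "HOL-Algebra.Sylow"
begin

text \<open>The source of all irreducible characters of degree \<open>p\<close> below is the following: a finite nonabelian group
with an abelian normal subgroup \<open>A\<close> of index \<open>p\<close> has one
(\<open>nonabelian_has_irr_character_of_prime_degree\<close>).  If \<open>y\<close> lies outside \<open>A\<close>, some commutator of an
element of \<open>A\<close> with \<open>y\<close> is nontrivial; a linear character \<open>\<chi>\<close> of \<open>A\<close> with a value other
than 1 at this commutator is moved by \<open>y\<close>, so its \<open>p\<close> conjugates are distinct and the
induced monomial representation of degree \<open>p\<close> is irreducible.  Characters are inflated along
surjective homomorphisms, so it suffices to find a quotient of this shape.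

Two consequences for a finite \<open>p\<close>-group \<open>G\<close> with maximal subgroups \<open>H \<noteq> M\<close> are combined.

First, a nonabelian \<open>p\<close>-group \<open>X\<close> with \<open>|X:X'| \<le> p^3\<close> has an irreducible character of degree \<open>p\<close>
(\<open>has_irr_character_of_small_abelianization\<close>).  A minimal nonabelian quotient
of \<open>X\<close> has a central derived subgroup of order \<open>p\<close>, hence order at most \<open>p^4\<close>, and then the centralizer of any
noncentral element is abelian of index \<open>p\<close>.

Second, suppose that \<open>H\<close> has no irreducible character of degree \<open>p\<close>.  In \<open>H/M'\<close> the subgroup
\<open>(H \<inter> M)/M'\<close> is abelian of index \<open>p\<close>, so \<open>H/M'\<close> must be abelian: \<open>H' \<le> M'\<close>
(\<open>exceptional_maximal_subgroup_derived\<close>).  Thus \<open>G/M'\<close> has two distinct abelian maximal subgroups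
\<open>H/M'\<close> and \<open>M/M'\<close>.  Its derived subgroup consists of the commutators of elements of \<open>M/M'\<close> with one
fixed element of \<open>H/M'\<close>, and these depend only on a coset of \<open>H\<close>; so \<open>|G':M'| \<le> p\<close>
(\<open>card_derived_le_of_maximal_subgroups\<close>), which says that \<open>|M:M'| \<le> |G:G'|\<close>.

In the situation of the theorem this gives \<open>|M:M'| \<le> p^3\<close> while \<open>|M| \<ge> p^4\<close>, so \<open>M\<close> is nonabelian and
the first consequence applies to \<open>M\<close>: no second exceptional subgroup exists.\<close>

section \<open>Linear characters of finite abelian groups\<close>

definition linear_character_on ::
  "('a, 'b) monoid_scheme \<Rightarrow> 'a set \<Rightarrow> ('a \<Rightarrow> complex) \<Rightarrow> bool" where
  "linear_character_on G A \<chi> \<longleftrightarrow>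
     (\<forall>x\<in>A. \<chi> x \<noteq> 0) \<and> (\<forall>x\<in>A. \<forall>y\<in>A. \<chi> (x \<otimes>\<^bsub>G\<^esub> y) = \<chi> x * \<chi> y)"

text \<open>The freedom to avoid the root 1 is what makes the extension of a character nontrivial at a new
element.\<close>

lemma complex_root_neq_one:
  fixes z :: complex
  assumes "z \<noteq> 0" and "2 \<le> n"
  shows "\<exists>\<mu>. \<mu> ^ n = z \<and> \<mu> \<noteq> 1"
proof -
  have "card {\<mu>. \<mu> ^ n = z} = n"
    using assms by (intro card_nth_roots) auto
  then have "\<not> {\<mu>. \<mu> ^ n = z} \<subseteq> {1}"
    using assms(2) card_mono[of "{1::complex}" "{\<mu>. \<mu> ^ n = z}"] by auto
  then show ?thesis by auto
qed

lemma (in group) linear_character_on_one: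
  assumes "linear_character_on G A \<chi>" and "\<one> \<in> A"
  shows "\<chi> \<one> = 1"
proof -
  have "\<chi> \<one> * \<chi> \<one> = \<chi> \<one>" "\<chi> \<one> \<noteq> 0"
    using assms unfolding linear_character_on_def by (metis r_one one_closed)+
  then show ?thesis by simp
qed

lemma (in group) linear_character_on_pow:
  assumes "linear_character_on G A \<chi>" and "subgroup A G" and "x \<in> A"
  shows "\<chi> (x [^] (k::nat)) = \<chi> x ^ k"
proof (induction k)
  case 0
  then show ?case
    using linear_character_on_one[OF assms(1)] subgroup.one_closed[OF assms(2)] by simp
next
  case (Suc k)
  have "x [^] k \<in> A"
    using subgroup_int_pow_closed[OF assms(2,3), of "int k"] by (simp add: int_pow_int)
  then show ?case
    using Suc assms unfolding linear_character_on_def by simp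
qed

text \<open>Let \<open>n\<close> be least with \<open>a\<^sup>n \<in> B\<close>.  The value at \<open>a\<close> may be any \<open>n\<close>-th root \<open>\<mu>\<close> of the value at
\<open>a\<^sup>n\<close>, and \<open>b a\<^sup>i \<mapsto> \<chi>(b) \<mu>\<^sup>i\<close> is then a well-defined extension to the subgroup generated by \<open>B\<close> and
\<open>a\<close>.  Since \<open>n \<ge> 2\<close>, the root can be taken different from 1.\<close>

lemma (in comm_group) extend_linear_character:
  assumes fin: "finite (carrier G)" and B: "subgroup B G"
    and \<chi>: "linear_character_on G B \<chi>" and a: "a \<in> carrier G" "a \<notin> B"
  shows "\<exists>B' \<chi>'. subgroup B' G \<and> B \<subset> B' \<and> a \<in> B' \<and> linear_character_on G B' \<chi>' \<and>
           (\<forall>b\<in>B. \<chi>' b = \<chi> b) \<and> \<chi>' a \<noteq> 1"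
proof -
  interpret B: subgroup B G by (rule B)
  define n where "n = (LEAST n::nat. 0 < n \<and> a [^] n \<in> B)"
  have "0 < Coset.order G \<and> a [^] Coset.order G \<in> B"
    using fin a by (simp add: pow_order_eq_1 order_gt_0_iff_finite)
  then have n: "0 < n" "a [^] n \<in> B"
    unfolding n_def by (metis (mono_tags, lifting) LeastI_ex)+
  have n_min: "n \<le> k" if "0 < k" "a [^] k \<in> B" for k :: nat
    unfolding n_def using that by (intro Least_le) auto
  have "n \<noteq> 1" using n a by auto
  with n have "2 \<le> n" by auto
  have \<chi>_nz: "\<chi> b \<noteq> 0" if "b \<in> B" for b
    using \<chi> that unfolding linear_character_on_def by auto
  have \<chi>_mult: "\<chi> (b \<otimes> c) = \<chi> b * \<chi> c" if "b \<in> B" "c \<in> B" for b c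
    using \<chi> that unfolding linear_character_on_def by auto
  obtain \<mu> where \<mu>: "\<mu> ^ n = \<chi> (a [^] n)" "\<mu> \<noteq> 1"
    using complex_root_neq_one[OF \<chi>_nz[OF n(2)] \<open>2 \<le> n\<close>] by blast
  have "\<mu> \<noteq> 0" using \<mu>(1) \<chi>_nz[OF n(2)] n(1) by (metis power_eq_0_iff)
  have pow_in_B: "\<chi> (a [^] k) = \<mu> ^ k" if "a [^] k \<in> B" for k :: nat
  proof -
    have split: "a [^] k = (a [^] n) [^] (k div n) \<otimes> a [^] (k mod n)"
      using a by (simp add: nat_pow_pow nat_pow_mult)
    have q: "(a [^] n) [^] (k div n) \<in> B"
      using subgroup_int_pow_closed[OF B n(2), of "int (k div n)"] by (simp add: int_pow_int)
    have "a [^] (k mod n) = inv ((a [^] n) [^] (k div n)) \<otimes> a [^] k"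
      unfolding split using a by (simp add: m_assoc[symmetric])
    then have "a [^] (k mod n) \<in> B" using q that by simp
    then have "k mod n = 0"
      using n_min[of "k mod n"] n(1) by (metis mod_less_divisor not_gr_zero not_le)
    then have k: "k = n * (k div n)" by auto
    then have "\<chi> (a [^] k) = \<chi> ((a [^] n) [^] (k div n))"
      using a by (metis nat_pow_pow)
    also have "\<dots> = (\<mu> ^ n) ^ (k div n)"
      using linear_character_on_pow[OF \<chi> B n(2)] \<mu> by simp
    also have "\<dots> = \<mu> ^ k" using k by (metis power_mult)
    finally show ?thesis .
  qed
  have well_defined_le: "\<chi> b * \<mu> ^ i = \<chi> c * \<mu> ^ j"
    if "b \<in> B" "c \<in> B" "i \<le> j" "b \<otimes> a [^] i = c \<otimes> a [^] j" for b c and i j :: nat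
  proof -
    have "b \<otimes> a [^] i = (c \<otimes> a [^] (j - i)) \<otimes> a [^] i"
      using that a by (simp add: m_assoc nat_pow_mult)
    then have b: "b = c \<otimes> a [^] (j - i)"
      using that a by simp
    then have "a [^] (j - i) = inv c \<otimes> b"
      using that a by (simp add: m_assoc[symmetric])
    then have "a [^] (j - i) \<in> B" using that by simp
    then have "\<chi> b = \<chi> c * \<mu> ^ (j - i)"
      using b that \<chi>_mult pow_in_B by metis
    then show ?thesis using that(3) by (simp add: mult.assoc flip: power_add)
  qed
  have well_defined: "\<chi> b * \<mu> ^ i = \<chi> c * \<mu> ^ j"
    if "b \<in> B" "c \<in> B" "b \<otimes> a [^] i = c \<otimes> a [^] j" for b c and i j :: nat
    using well_defined_le[of b c i j] well_defined_le[of c b j i] that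
    by (cases "i \<le> j") simp_all
  define B' where "B' = {b \<otimes> a [^] i | b (i::nat). b \<in> B}"
  define \<chi>' where "\<chi>' x = (THE z. \<exists>b\<in>B. \<exists>i::nat. x = b \<otimes> a [^] i \<and> z = \<chi> b * \<mu> ^ i)" for x
  have \<chi>': "\<chi>' (b \<otimes> a [^] i) = \<chi> b * \<mu> ^ i" if "b \<in> B" for b and i :: nat
    unfolding \<chi>'_def
  proof (rule the_equality)
    show "\<exists>c\<in>B. \<exists>j::nat. b \<otimes> a [^] i = c \<otimes> a [^] j \<and> \<chi> b * \<mu> ^ i = \<chi> c * \<mu> ^ j"
      using that by blast
    fix z
    assume "\<exists>c\<in>B. \<exists>j::nat. b \<otimes> a [^] i = c \<otimes> a [^] j \<and> z = \<chi> c * \<mu> ^ j"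
    then obtain c and j :: nat where c: "c \<in> B" "b \<otimes> a [^] i = c \<otimes> a [^] j" "z = \<chi> c * \<mu> ^ j"
      by blast
    show "z = \<chi> b * \<mu> ^ i"
      unfolding c(3) by (rule well_defined[OF that c(1,2), symmetric])
  qed
  have sub: "subgroup B' G"
  proof (rule subgroupI)
    show "B' \<subseteq> carrier G" using a by (auto simp: B'_def)
    show "B' \<noteq> {}" using B.one_closed unfolding B'_def by blast
    fix x assume "x \<in> B'"
    then obtain b and i :: nat where x: "b \<in> B" "x = b \<otimes> a [^] i" by (auto simp: B'_def)
    \<comment> \<open>only powers with natural exponents occur in \<open>B'\<close>, so an inverse is written as a power\<close>
    have "inv (a [^] i) = a [^] (i * (Coset.order G - 1))"
    proof (rule inv_equality)
      have "a [^] (i * (Coset.order G - 1)) \<otimes> a [^] i = a [^] (i * (Coset.order G - 1) + i)"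
        using a by (simp add: nat_pow_mult)
      also have "i * (Coset.order G - 1) + i = Coset.order G * i"
        using fin order_gt_0_iff_finite by (cases "Coset.order G") auto
      also have "a [^] (Coset.order G * i) = (a [^] Coset.order G) [^] i"
        using a by (simp add: nat_pow_pow)
      also have "\<dots> = \<one>" using a fin by (simp add: pow_order_eq_1)
      finally show "a [^] (i * (Coset.order G - 1)) \<otimes> a [^] i = \<one>" .
    qed (use a in auto)
    then have "inv x = inv b \<otimes> a [^] (i * (Coset.order G - 1))"
      using x a by (simp add: inv_mult)
    then show "inv x \<in> B'" using x by (auto simp: B'_def)
    fix y assume "y \<in> B'"
    then obtain c and j :: nat where y: "c \<in> B" "y = c \<otimes> a [^] j" by (auto simp: B'_def)
    have "x \<otimes> y = (b \<otimes> c) \<otimes> a [^] (i + j)"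
      using x y a by (simp add: nat_pow_mult[symmetric] m_ac)
    then show "x \<otimes> y \<in> B'" using x y unfolding B'_def by blast
  qed
  have "linear_character_on G B' \<chi>'"
    unfolding linear_character_on_def
  proof (intro conjI ballI)
    fix x assume "x \<in> B'"
    then obtain b and i :: nat where x: "b \<in> B" "x = b \<otimes> a [^] i" by (auto simp: B'_def)
    show "\<chi>' x \<noteq> 0" using x \<chi>' \<chi>_nz \<open>\<mu> \<noteq> 0\<close> by simp
    fix y assume "y \<in> B'"
    then obtain c and j :: nat where y: "c \<in> B" "y = c \<otimes> a [^] j" by (auto simp: B'_def)
    have "x \<otimes> y = (b \<otimes> c) \<otimes> a [^] (i + j)"
      using x y a by (simp add: nat_pow_mult[symmetric] m_ac)
    then show "\<chi>' (x \<otimes> y) = \<chi>' x * \<chi>' y"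
      using x y \<chi>' \<chi>_mult by (simp add: power_add)
  qed
  moreover have "\<chi>' b = \<chi> b" if "b \<in> B" for b
    using \<chi>'[OF that, of 0] that by simp
  moreover have "\<chi>' a \<noteq> 1"
    using \<chi>'[OF B.one_closed, of 1] linear_character_on_one[OF \<chi> B.one_closed] a \<mu> by simp
  moreover have "b \<in> B'" if "b \<in> B" for b
    unfolding B'_def using that by (auto intro!: exI[of _ b] exI[of _ "0::nat"])
  moreover have "a \<in> B'"
    unfolding B'_def using a B.one_closed by (auto intro!: exI[of _ \<one>] exI[of _ "1::nat"])
  ultimately show ?thesis using sub a(2) by blast
qed

text \<open>Start from the trivial character of the trivial subgroup, extend it to a character with a value
other than 1 at \<open>c\<close>, and then extend further until the whole group is reached.\<close>

lemma (in comm_group) linear_character_separates: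
  assumes fin: "finite (carrier G)" and c: "c \<in> carrier G" "c \<noteq> \<one>"
  shows "\<exists>\<chi>. linear_character_on G (carrier G) \<chi> \<and> \<chi> c \<noteq> 1"
proof -
  define P where "P B \<longleftrightarrow> subgroup B G \<and> c \<in> B \<and> (\<exists>\<chi>. linear_character_on G B \<chi> \<and> \<chi> c \<noteq> 1)" for B
  have "linear_character_on G {\<one>} (\<lambda>_. 1)"
    by (simp add: linear_character_on_def)
  then have "\<exists>B. P B"
    using extend_linear_character[OF fin triv_subgroup _ c(1)] c(2) unfolding P_def by blast
  moreover have "finite {B. P B}"
    by (rule finite_subset[of _ "Pow (carrier G)"]) (auto simp: P_def fin dest: subgroup.subset)
  ultimately obtain B where B: "P B" and max: "\<And>B'. P B' \<Longrightarrow> B \<subseteq> B' \<Longrightarrow> B' = B"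
    using finite_has_maximal[of "{B. P B}"] by auto
  then obtain \<chi> where \<chi>: "subgroup B G" "c \<in> B" "linear_character_on G B \<chi>" "\<chi> c \<noteq> 1"
    unfolding P_def by blast
  have "B = carrier G"
  proof (rule ccontr)
    assume "B \<noteq> carrier G"
    then obtain a where "a \<in> carrier G" "a \<notin> B" using subgroup.subset[OF \<chi>(1)] by auto
    from extend_linear_character[OF fin \<chi>(1,3) this] obtain B' \<chi>' where
      "subgroup B' G" "B \<subset> B'" "linear_character_on G B' \<chi>'" "\<chi>' c = \<chi> c"
      using \<chi>(2) by blast
    then have "P B'" unfolding P_def using \<chi> by auto
    with max \<open>B \<subset> B'\<close> show False by blast
  qed
  then show ?thesis using \<chi> by blast
qed

section \<open>Representations induced from a normal subgroup of prime index\<close>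

text \<open>The powers \<open>y\<^sup>0, \<dots>, y\<^sup>p\<^sup>-\<^sup>1\<close> serve as representatives of the cosets of \<open>A\<close>; with this choice the conjugates of
\<open>\<chi>\<close> are indexed by the exponents, and arithmetic modulo \<open>p\<close> decides when two of them agree.\<close>

locale induced_character = group G for G (structure) +
  fixes A :: "'a set" and \<chi> :: "'a \<Rightarrow> complex" and y :: 'a and p :: nat
  assumes normal: "A \<lhd> G"
    and index: "card (rcosets A) = p" and prime: "Factorial_Ring.prime p"
    and y: "y \<in> carrier G" "y \<notin> A"
    and character: "linear_character_on G A \<chi>"
begin

sublocale A: normal A G by (rule normal)

lemma pow_y_closed [simp]: "y [^] (i::nat) \<in> carrier G"
  using y by simp

text \<open>The coset of \<open>y\<close> is a nontrivial element of a group of prime order \<open>p\<close>, hence has order \<open>p\<close>.\<close>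

lemma pow_y_mem_iff: "y [^] (i::nat) \<in> A \<longleftrightarrow> p dvd i"
proof -
  interpret Q: group "G Mod A" by (rule A.factorgroup_is_group)
  have mem: "A #> y \<in> carrier (G Mod A)" using y by (auto simp: carrier_FactGroup)
  have iff: "A #> x = A \<longleftrightarrow> x \<in> A" if "x \<in> carrier G" for x
    using that coset_join1 coset_join2 A.subgroup_axioms A.subset by metis
  have "Q.ord (A #> y) dvd p"
    using Q.ord_dvd_group_order[OF mem] index by (simp add: Coset.order_def FactGroup_def)
  moreover have "Q.ord (A #> y) \<noteq> 1"
    using Q.ord_eq_1[OF mem] iff y by simp
  ultimately have "Q.ord (A #> y) = p"
    using prime prime_nat_iff by blast
  then show ?thesis
    using Q.pow_eq_id[OF mem, of i] A.FactGroup_pow[OF y(1), of i] iff[of "y [^] i"] by simp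
qed

lemma inv_pow_y_pow_mem_iff:
  assumes "i < p" "j < p"
  shows "inv (y [^] i) \<otimes> y [^] j \<in> A \<longleftrightarrow> i = j"
proof -
  have le: "inv (y [^] i) \<otimes> y [^] j \<in> A \<longleftrightarrow> i = j" if "i \<le> j" "j < p" for i j
  proof -
    have "inv (y [^] i) \<otimes> y [^] j = inv (y [^] i) \<otimes> (y [^] i \<otimes> y [^] (j - i))"
      using that y by (simp add: nat_pow_mult)
    also have "\<dots> = y [^] (j - i)" using y by (simp add: m_assoc[symmetric])
    finally have "inv (y [^] i) \<otimes> y [^] j \<in> A \<longleftrightarrow> p dvd j - i"
      using pow_y_mem_iff[of "j - i"] by simp
    then show ?thesis using that dvd_imp_le[of p "j - i"] by (cases "i = j") auto
  qed
  show ?thesis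
  proof (cases "i \<le> j")
    case True
    then show ?thesis using le assms by simp
  next
    case False
    have "inv (inv (y [^] i) \<otimes> y [^] j) = inv (y [^] j) \<otimes> y [^] i"
      by (simp add: inv_mult_group)
    then have "inv (y [^] i) \<otimes> y [^] j \<in> A \<Longrightarrow> inv (y [^] j) \<otimes> y [^] i \<in> A"
      using A.m_inv_closed by metis
    then show ?thesis using le[of j i] False assms by auto
  qed
qed

lemma ex1_pow_y_coset:
  assumes g: "g \<in> carrier G"
  shows "\<exists>!j. j < p \<and> inv (y [^] j) \<otimes> g \<in> A"
proof -
  have rcos_eq: "A #> g = A #> h \<longleftrightarrow> inv g \<otimes> h \<in> A" if "g \<in> carrier G" "h \<in> carrier G" for g h
  proof -
    have "A #> g = A #> h \<longleftrightarrow> g <# A = h <# A"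
      using that A.coset_eq by metis
    also have "\<dots> \<longleftrightarrow> h \<in> g <# A"
    proof
      assume "g <# A = h <# A"
      moreover have "h \<in> h <# A" using that by (auto simp: l_coset_def intro!: bexI[of _ \<one>])
      ultimately show "h \<in> g <# A" by simp
    qed (use that l_repr_independence[OF _ _ A.subgroup_axioms] in blast)
    also have "\<dots> \<longleftrightarrow> inv g \<otimes> h \<in> A"
    proof
      assume "h \<in> g <# A"
      then obtain a where "a \<in> A" "h = g \<otimes> a" by (auto simp: l_coset_def)
      then show "inv g \<otimes> h \<in> A" using that by (simp add: m_assoc[symmetric])
    next
      assume "inv g \<otimes> h \<in> A"
      moreover have "h = g \<otimes> (inv g \<otimes> h)" using that by (simp add: m_assoc[symmetric])
      ultimately show "h \<in> g <# A" by (auto simp: l_coset_def)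
    qed
    finally show ?thesis .
  qed
  have inj: "inj_on (\<lambda>j. A #> y [^] j) {..<p}"
    by (rule inj_onI) (use rcos_eq inv_pow_y_pow_mem_iff in auto)
  have "(\<lambda>j. A #> y [^] j) ` {..<p} = rcosets A"
  proof (rule card_subset_eq)
    show "finite (rcosets A)"
      using index prime by (metis card.infinite not_prime_0)
    show "(\<lambda>j. A #> y [^] j) ` {..<p} \<subseteq> rcosets A"
      using pow_y_closed unfolding RCOSETS_def by blast
    show "card ((\<lambda>j. A #> y [^] j) ` {..<p}) = card (rcosets A)"
      using card_image[OF inj] index by simp
  qed
  moreover have "A #> g \<in> rcosets A" using g by (auto simp: RCOSETS_def)
  ultimately have "A #> g \<in> (\<lambda>j. A #> y [^] j) ` {..<p}" by simp
  then obtain j where j: "j < p" "A #> y [^] j = A #> g" by auto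
  show ?thesis
  proof (rule ex1I[of _ j])
    show "j < p \<and> inv (y [^] j) \<otimes> g \<in> A"
      using j rcos_eq[OF pow_y_closed g] by blast
    fix l assume l: "l < p \<and> inv (y [^] l) \<otimes> g \<in> A"
    then have "A #> y [^] l = A #> y [^] j"
      using j rcos_eq[OF pow_y_closed g] by metis
    then show "l = j" using inj_onD[OF inj] l j by blast
  qed
qed

definition extension_by_zero :: "'a \<Rightarrow> complex" where
  "extension_by_zero x = (if x \<in> A then \<chi> x else 0)"

text \<open>The matrix of \<open>g\<close> on the module induced from \<open>\<chi>\<close>, in the basis given by the coset representatives
\<open>y\<^sup>i\<close>.  Every row and every column has exactly one nonzero entry.\<close>

definition induced_matrix :: "'a \<Rightarrow> complex mat" where
  "induced_matrix g =
     mat p p (\<lambda>(i, j). extension_by_zero (inv (y [^] i) \<otimes> g \<otimes> y [^] j))"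

lemma \<chi>_mult: "a \<in> A \<Longrightarrow> b \<in> A \<Longrightarrow> \<chi> (a \<otimes> b) = \<chi> a * \<chi> b"
  using character unfolding linear_character_on_def by blast

lemma \<chi>_nonzero: "a \<in> A \<Longrightarrow> \<chi> a \<noteq> 0"
  using character unfolding linear_character_on_def by blast

lemma extension_by_zero_mult:
  assumes "x \<in> carrier G" "a \<in> A"
  shows "extension_by_zero (x \<otimes> a) = extension_by_zero x * \<chi> a"
proof (cases "x \<in> A")
  case True
  then show ?thesis using assms \<chi>_mult by (simp add: extension_by_zero_def)
next
  case False
  have "x \<otimes> a \<notin> A"
  proof
    assume "x \<otimes> a \<in> A"
    then have "x \<otimes> a \<otimes> inv a \<in> A" using assms by blast
    then show False using False assms by (simp add: m_assoc)
  qed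
  with False show ?thesis by (simp add: extension_by_zero_def)
qed

lemma induced_matrix_carrier [simp]: "induced_matrix g \<in> carrier_mat p p"
  by (simp add: induced_matrix_def)

lemma induced_matrix_one: "induced_matrix \<one> = 1\<^sub>m p"
proof -
  have "\<chi> \<one> = 1" using linear_character_on_one[OF character] by simp
  then show ?thesis
    by (intro eq_matI)
       (auto simp: induced_matrix_def extension_by_zero_def inv_pow_y_pow_mem_iff)
qed

lemma induced_matrix_mult:
  assumes g: "g \<in> carrier G" and h: "h \<in> carrier G"
  shows "induced_matrix (g \<otimes> h) = induced_matrix g * induced_matrix h"
proof (rule eq_matI)
  fix i k assume "i < dim_row (induced_matrix g * induced_matrix h)"
    and "k < dim_col (induced_matrix g * induced_matrix h)"
  then have i: "i < p" and k: "k < p" by (auto simp: induced_matrix_def)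
  let ?e = extension_by_zero
  let ?t = "\<lambda>j. ?e (inv (y [^] i) \<otimes> g \<otimes> y [^] j) * ?e (inv (y [^] j) \<otimes> h \<otimes> y [^] k)"
  have assoc: "inv (y [^] j) \<otimes> h \<otimes> y [^] k = inv (y [^] j) \<otimes> (h \<otimes> y [^] k)" for j :: nat
    using h by (simp add: m_assoc)
  \<comment> \<open>in column \<open>k\<close> of the matrix of \<open>h\<close> only one entry is nonzero, so the sum defining the product has a single term\<close>
  obtain j where j: "j < p" "inv (y [^] j) \<otimes> h \<otimes> y [^] k \<in> A"
    and uniq: "\<And>l. l < p \<Longrightarrow> inv (y [^] l) \<otimes> h \<otimes> y [^] k \<in> A \<Longrightarrow> l = j"
    using ex1_pow_y_coset[OF m_closed[OF h pow_y_closed[of k]]] unfolding assoc by blast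
  have "(induced_matrix g * induced_matrix h) $$ (i, k) = (\<Sum>l\<in>{0..<p}. ?t l)"
    using i k by (simp add: induced_matrix_def scalar_prod_def)
  also have "\<dots> = (\<Sum>l\<in>{j}. ?t l)"
  proof (rule sum.mono_neutral_right)
    show "\<forall>l\<in>{0..<p} - {j}. ?t l = 0"
      using uniq unfolding extension_by_zero_def by auto
  qed (use j in simp_all)
  also have "\<dots> = ?e ((inv (y [^] i) \<otimes> g \<otimes> y [^] j) \<otimes> (inv (y [^] j) \<otimes> h \<otimes> y [^] k))"
    using extension_by_zero_mult[OF _ j(2)] j(2) g by (simp add: extension_by_zero_def)
  also have "(inv (y [^] i) \<otimes> g \<otimes> y [^] j) \<otimes> (inv (y [^] j) \<otimes> h \<otimes> y [^] k) =
      inv (y [^] i) \<otimes> (g \<otimes> h) \<otimes> y [^] k"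
  proof -
    have "(inv (y [^] i) \<otimes> g \<otimes> y [^] j) \<otimes> (inv (y [^] j) \<otimes> h \<otimes> y [^] k) =
        inv (y [^] i) \<otimes> g \<otimes> (y [^] j \<otimes> inv (y [^] j)) \<otimes> h \<otimes> y [^] k"
      using g h by (simp add: m_assoc del: r_inv Units_r_inv)
    also have "\<dots> = inv (y [^] i) \<otimes> g \<otimes> h \<otimes> y [^] k"
      using g h by simp
    also have "\<dots> = inv (y [^] i) \<otimes> (g \<otimes> h) \<otimes> y [^] k"
      using g h m_assoc[of "inv (y [^] i)" g h] by simp
    finally show ?thesis .
  qed
  also have "?e (inv (y [^] i) \<otimes> (g \<otimes> h) \<otimes> y [^] k) = induced_matrix (g \<otimes> h) $$ (i, k)"
    using i k by (simp add: induced_matrix_def)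
  finally show "induced_matrix (g \<otimes> h) $$ (i, k) = (induced_matrix g * induced_matrix h) $$ (i, k)"
    by (rule sym)
qed (auto simp: induced_matrix_def)

lemma representation_induced_matrix: "representation G p induced_matrix"
  unfolding representation_def
proof (rule homI)
  fix g assume g: "g \<in> carrier G"
  have "induced_matrix g * induced_matrix (inv g) = 1\<^sub>m p"
    "induced_matrix (inv g) * induced_matrix g = 1\<^sub>m p"
    using g induced_matrix_mult[of g "inv g"] induced_matrix_mult[of "inv g" g]
    by (simp_all add: induced_matrix_one)
  then show "induced_matrix g \<in> carrier (GL_complex p)"
    unfolding units_of_def Units_def
    by (auto simp: ring_mat_simps intro!: bexI[of _ "induced_matrix (inv g)"])
next
  fix g h assume "g \<in> carrier G" "h \<in> carrier G"
  then show "induced_matrix (g \<otimes> h) = induced_matrix g \<otimes>\<^bsub>GL_complex p\<^esub> induced_matrix h"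
    by (simp add: induced_matrix_mult units_of_def ring_mat_simps)
qed

lemma induced_matrix_vec:
  assumes "w \<in> carrier_vec p" "i < p"
  shows "(induced_matrix g *\<^sub>v w) $ i =
    (\<Sum>j\<in>{0..<p}. extension_by_zero (inv (y [^] i) \<otimes> g \<otimes> y [^] j) * w $ j)"
  using assms by (simp add: induced_matrix_def scalar_prod_def)

definition conj_y :: "nat \<Rightarrow> 'a \<Rightarrow> 'a" where
  "conj_y k a = inv (y [^] k) \<otimes> a \<otimes> y [^] k"

lemma conj_y_closed: "a \<in> A \<Longrightarrow> conj_y k a \<in> A"
  unfolding conj_y_def by (rule A.inv_op_closed1) simp_all

lemma conj_y_add:
  assumes "a \<in> A"
  shows "conj_y (k + l) a = conj_y l (conj_y k a)"
proof -
  have "conj_y (k + l) a = inv (y [^] k \<otimes> y [^] l) \<otimes> a \<otimes> (y [^] k \<otimes> y [^] l)"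
    unfolding conj_y_def using y by (simp add: nat_pow_mult)
  also have "\<dots> = conj_y l (conj_y k a)"
    unfolding conj_y_def using assms by (simp add: inv_mult_group m_assoc)
  finally show ?thesis .
qed

lemma conj_y_surj:
  assumes "b \<in> A"
  shows "\<exists>a\<in>A. conj_y k a = b"
proof
  show "y [^] k \<otimes> b \<otimes> inv (y [^] k) \<in> A"
    using assms by (intro A.inv_op_closed2) simp_all
  have "conj_y k (y [^] k \<otimes> b \<otimes> inv (y [^] k)) =
      (inv (y [^] k) \<otimes> y [^] k) \<otimes> b \<otimes> (inv (y [^] k) \<otimes> y [^] k)"
    unfolding conj_y_def using assms by (simp add: m_assoc del: l_inv Units_l_inv)
  then show "conj_y k (y [^] k \<otimes> b \<otimes> inv (y [^] k)) = b" using assms by simp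
qed

lemma induced_matrix_diagonal:
  assumes a: "a \<in> A" and w: "w \<in> carrier_vec p" and i: "i < p"
  shows "(induced_matrix a *\<^sub>v w) $ i = \<chi> (conj_y i a) * w $ i"
proof -
  let ?e = extension_by_zero
  have "?e (inv (y [^] i) \<otimes> a \<otimes> y [^] j) = 0" if "j < p" "j \<noteq> i" for j
  proof -
    have "inv (y [^] i) \<otimes> a \<otimes> y [^] j = conj_y i a \<otimes> (inv (y [^] i) \<otimes> y [^] j)"
      unfolding conj_y_def using a
      by (simp add: m_assoc) (simp add: m_assoc[symmetric])
    moreover have "\<dots> \<notin> A"
    proof
      assume "conj_y i a \<otimes> (inv (y [^] i) \<otimes> y [^] j) \<in> A"
      then have "inv (conj_y i a) \<otimes> (conj_y i a \<otimes> (inv (y [^] i) \<otimes> y [^] j)) \<in> A"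
        using conj_y_closed[OF a, of i] by blast
      then have "inv (y [^] i) \<otimes> y [^] j \<in> A"
        using A.mem_carrier[OF conj_y_closed[OF a, of i]] by (simp add: m_assoc[symmetric])
      then show False using inv_pow_y_pow_mem_iff[of i j] that i by simp
    qed
    ultimately show ?thesis by (simp add: extension_by_zero_def)
  qed
  then have "(induced_matrix a *\<^sub>v w) $ i =
      (\<Sum>j\<in>{i}. ?e (inv (y [^] i) \<otimes> a \<otimes> y [^] j) * w $ j)"
    unfolding induced_matrix_vec[OF w i] using i by (intro sum.mono_neutral_right) auto
  then show ?thesis
    using conj_y_closed[OF a, of i] by (simp add: extension_by_zero_def conj_y_def)
qed

text \<open>If the conjugates of \<open>\<chi>\<close> by \<open>y\<^sup>i\<close> and \<open>y\<^sup>j\<close> agree, then \<open>\<chi>\<close> is fixed by \<open>y\<^sup>d\<close> with \<open>d = j - i\<close> prime to \<open>p\<close>,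
hence by some power \<open>y\<^sup>1\<^sup>+\<^sup>p\<^sup>q\<close>.  As \<open>y\<^sup>p\<^sup>q \<in> A\<close> acts trivially on characters of \<open>A\<close>, \<open>\<chi>\<close> would be fixed
by \<open>y\<close>.\<close>

lemma conj_y_characters_distinct:
  assumes nontriv: "c \<in> A" "\<chi> (conj_y 1 c) \<noteq> \<chi> c" and ij: "i < j" "j < p"
  shows "\<exists>a\<in>A. \<chi> (conj_y i a) \<noteq> \<chi> (conj_y j a)"
proof (rule ccontr)
  assume "\<not> ?thesis"
  then have eq: "\<chi> (conj_y i a) = \<chi> (conj_y j a)" if "a \<in> A" for a
    using that by blast
  define d where "d = j - i"
  have d: "0 < d" "d < p" using ij by (auto simp: d_def)
  have inv_d: "\<chi> (conj_y d b) = \<chi> b" if "b \<in> A" for b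
  proof -
    obtain a where a: "a \<in> A" "conj_y i a = b" using conj_y_surj \<open>b \<in> A\<close> by blast
    then have "conj_y d b = conj_y j a"
      using conj_y_add[OF a(1), of i d] ij by (simp add: d_def)
    then show ?thesis using eq a by metis
  qed
  have inv_dm: "\<chi> (conj_y (d * m) b) = \<chi> b" if "b \<in> A" for b m
  proof (induction m)
    case 0
    show ?case using that by (simp add: conj_y_def)
  next
    case (Suc m)
    then show ?case
      using conj_y_add[OF that, of "d * m" d] inv_d[OF conj_y_closed[OF that]]
      by (simp add: add.commute)
  qed
  have "coprime d p"
    using d prime by (meson coprime_commute nat_dvd_not_less prime_imp_coprime)
  then obtain m q where mq: "d * m = p * q + 1"
    using bezout_nat[of d p] d by (auto simp: coprime_iff_gcd_eq_1)
  define u where "u = y [^] (p * q)"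
  have u: "u \<in> A" unfolding u_def by (subst pow_y_mem_iff) simp
  have "conj_y (d * m) c = conj_y (p * q) (conj_y 1 c)"
    using conj_y_add[OF nontriv(1), of 1 "p * q"] mq by simp
  also have "\<dots> = inv u \<otimes> conj_y 1 c \<otimes> u" by (simp add: conj_y_def u_def)
  finally have "\<chi> (conj_y (d * m) c) = \<chi> (inv u) * \<chi> (conj_y 1 c) * \<chi> u"
    using u conj_y_closed[OF nontriv(1), of 1] by (simp add: \<chi>_mult)
  also have "\<chi> (inv u) * \<chi> u = 1"
    using u \<chi>_mult[of "inv u" u] linear_character_on_one[OF character] by simp
  then have "\<chi> (inv u) * \<chi> (conj_y 1 c) * \<chi> u = \<chi> (conj_y 1 c)" by simp
  finally show False using inv_dm[OF nontriv(1), of m] nontriv(2) by simp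
qed

text \<open>The elements of \<open>A\<close> act diagonally through \<open>p\<close> distinct characters.  A nonzero vector of minimal
support in an invariant subspace \<open>W\<close> must have a single nonzero entry, as otherwise
\<open>\<rho>(a) w - \<chi>\<^sub>i(a) w\<close> would have smaller support for a suitable \<open>a\<close>.  So \<open>W\<close> contains a basis vector,
and the powers of \<open>y\<close> carry it to all the others.\<close>

lemma irreducible_induced_matrix:
  assumes nontriv: "c \<in> A" "\<chi> (conj_y 1 c) \<noteq> \<chi> c"
  shows "irreducible_representation G p induced_matrix"
  unfolding irreducible_representation_def
proof (intro conjI allI impI)
  show "representation G p induced_matrix" by (rule representation_induced_matrix)
  show "0 < p" using prime prime_gt_0_nat by blast
  fix W assume "VectorSpace.subspace class_ring W (module_vec TYPE(complex) p)"
  then have W: "W \<subseteq> carrier_vec p" "0\<^sub>v p \<in> W"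
    and W_add: "\<And>v w. v \<in> W \<Longrightarrow> w \<in> W \<Longrightarrow> v + w \<in> W"
    and W_smult: "\<And>s v. v \<in> W \<Longrightarrow> s \<cdot>\<^sub>v v \<in> W"
    unfolding VectorSpace.subspace_def LinearCombinations.submodule_def
    by (auto simp: module_vec_simps)
  assume inv: "\<forall>g\<in>carrier G. \<forall>w\<in>W. induced_matrix g *\<^sub>v w \<in> W"
  show "W = {0\<^sub>v p} \<or> W = carrier_vec p"
  proof (cases "W = {0\<^sub>v p}")
    case False
    then obtain w0 where w0: "w0 \<in> W" "w0 \<noteq> 0\<^sub>v p" using W(2) by blast
    define supp where "supp w = {i. i < p \<and> w $ i \<noteq> 0}" for w :: "complex vec"
    have fin_supp: "finite (supp w)" for w by (simp add: supp_def)
    have supp_nonempty: "supp w \<noteq> {}" if "w \<in> W" "w \<noteq> 0\<^sub>v p" for w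
      using that W(1) by (auto simp: supp_def intro!: eq_vecI)
    obtain w where w: "w \<in> W" "w \<noteq> 0\<^sub>v p"
      and min: "\<And>v. v \<in> W \<Longrightarrow> v \<noteq> 0\<^sub>v p \<Longrightarrow> card (supp w) \<le> card (supp v)"
      using ex_has_least_nat[of "\<lambda>w. w \<in> W \<and> w \<noteq> 0\<^sub>v p" w0 "\<lambda>w. card (supp w)"] w0 by blast
    have wp: "w \<in> carrier_vec p" using w W by auto
    obtain i where i: "i \<in> supp w" using supp_nonempty[OF w] by blast
    then have ip: "i < p" and wi: "w $ i \<noteq> 0" by (auto simp: supp_def)
    have supp_w: "j = i" if j: "j \<in> supp w" for j
    proof (rule ccontr)
      assume "j \<noteq> i"
      have jp: "j < p" and wj: "w $ j \<noteq> 0" using j by (auto simp: supp_def)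
      obtain a where a: "a \<in> A" "\<chi> (conj_y i a) \<noteq> \<chi> (conj_y j a)"
        using conj_y_characters_distinct[OF nontriv, of i j]
          conj_y_characters_distinct[OF nontriv, of j i] ip jp \<open>j \<noteq> i\<close>
        by (metis nat_neq_iff)
      define v where "v = induced_matrix a *\<^sub>v w + (- \<chi> (conj_y i a)) \<cdot>\<^sub>v w"
      have vW: "v \<in> W"
        unfolding v_def using inv a(1) w(1) by (intro W_add W_smult) auto
      have v: "v $ k = (\<chi> (conj_y k a) - \<chi> (conj_y i a)) * w $ k" if "k < p" for k
        using that wp induced_matrix_diagonal[OF a(1) wp that]
        by (simp add: v_def algebra_simps)
      have "v $ j \<noteq> 0" using v[OF jp] a(2) wj by simp
      then have "v \<noteq> 0\<^sub>v p" using jp by auto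
      have "supp v \<subseteq> supp w" by (auto simp: supp_def v)
      moreover have "i \<notin> supp v" by (simp add: supp_def v)
      ultimately have "supp v \<subset> supp w" using i by blast
      from psubset_card_mono[OF fin_supp this] min[OF vW \<open>v \<noteq> 0\<^sub>v p\<close>]
      show False by simp
    qed
    have unit_i: "unit_vec p i \<in> W"
    proof -
      have "unit_vec p i = (1 / w $ i) \<cdot>\<^sub>v w"
      proof (rule eq_vecI)
        fix k assume "k < dim_vec ((1 / w $ i) \<cdot>\<^sub>v w)"
        then have "k < p" using wp by simp
        then show "unit_vec p i $ k = ((1 / w $ i) \<cdot>\<^sub>v w) $ k"
        proof (cases "k = i")
          case False
          then have "w $ k = 0" using supp_w \<open>k < p\<close> by (auto simp: supp_def)
          then show ?thesis using False \<open>k < p\<close> wp ip by simp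
        qed (use wp wi ip in simp)
      qed (use wp in auto)
      then show ?thesis using W_smult w(1) by simp
    qed
    have unit_k: "unit_vec p k \<in> W" if k: "k < p" for k
    proof -
      define g where "g = y [^] k \<otimes> inv (y [^] i)"
      have "induced_matrix g *\<^sub>v unit_vec p i = unit_vec p k"
      proof (rule eq_vecI)
        fix l assume "l < dim_vec (unit_vec p k :: complex vec)"
        then have l: "l < p" by simp
        have "(induced_matrix g *\<^sub>v unit_vec p i) $ l =
            (\<Sum>j\<in>{i}. extension_by_zero (inv (y [^] l) \<otimes> g \<otimes> y [^] j) * unit_vec p i $ j)"
          unfolding induced_matrix_vec[OF unit_vec_carrier l]
          using ip by (intro sum.mono_neutral_right) auto
        also have "\<dots> = extension_by_zero (inv (y [^] l) \<otimes> g \<otimes> y [^] i)" using ip by simp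
        also have "inv (y [^] l) \<otimes> g \<otimes> y [^] i = inv (y [^] l) \<otimes> y [^] k"
          by (simp add: g_def m_assoc)
        finally show "(induced_matrix g *\<^sub>v unit_vec p i) $ l = unit_vec p k $ l"
          using inv_pow_y_pow_mem_iff[OF l k] linear_character_on_one[OF character] k l
          by (auto simp: extension_by_zero_def)
      qed (simp add: induced_matrix_def)
      then show ?thesis using inv unit_i by (metis g_def m_closed inv_closed pow_y_closed)
    qed
    have "v \<in> W" if v: "v \<in> carrier_vec p" for v
    proof -
      \<comment> \<open>the coordinates of \<open>v\<close> are added one at a time\<close>
      have "vec p (\<lambda>k. if k < m then v $ k else 0) \<in> W" if "m \<le> p" for m
        using that
      proof (induction m)
        case 0
        have "vec p (\<lambda>k. if k < 0 then v $ k else 0) = 0\<^sub>v p" by auto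
        then show ?case using W by simp
      next
        case (Suc m)
        have "vec p (\<lambda>k. if k < Suc m then v $ k else 0) =
            vec p (\<lambda>k. if k < m then v $ k else 0) + v $ m \<cdot>\<^sub>v unit_vec p m"
          using Suc(2) by (intro eq_vecI) (auto simp: less_Suc_eq)
        then show ?case using Suc W_add W_smult unit_k by simp
      qed
      from this[of p] have "vec p (\<lambda>k. if k < p then v $ k else 0) \<in> W" by simp
      moreover have "vec p (\<lambda>k. if k < p then v $ k else 0) = v" using v by auto
      ultimately show ?thesis by simp
    qed
    then show ?thesis using W by auto
  qed simp
qed

end

lemma has_irr_character_of_degreeI:
  assumes "group G" and \<rho>: "irreducible_representation G n \<rho>"
  shows "has_irr_character_of_degree G n"
proof -
  interpret group G by fact
  have "\<rho> \<in> hom G (GL_complex n)"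
    using \<rho> by (simp add: irreducible_representation_def representation_def)
  moreover have "group (GL_complex n)"
  proof -
    interpret R: ring "ring_mat TYPE(complex) n ()" by (rule ring_mat)
    show ?thesis by (rule R.units_group)
  qed
  ultimately have "\<rho> \<one>\<^bsub>G\<^esub> = \<one>\<^bsub>GL_complex n\<^esub>" using hom_one is_group by blast
  then have "\<rho> \<one>\<^bsub>G\<^esub> = 1\<^sub>m n" by (simp add: units_of_def ring_mat_simps)
  then have "mat_trace (\<rho> \<one>\<^bsub>G\<^esub>) = of_nat n" by (simp add: mat_trace_def)
  moreover have "(\<lambda>g\<in>carrier G. mat_trace (\<rho> g)) \<in> irr_characters G"
    using \<rho> unfolding irr_characters_def by blast
  ultimately show ?thesis
    unfolding has_irr_character_of_degree_def char_degree_def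
    by (intro bexI[of _ "\<lambda>g\<in>carrier G. mat_trace (\<rho> g)"]) simp_all
qed

text \<open>A character \<open>\<chi>\<close> of \<open>A\<close> with \<open>\<chi>(c a\<^sup>-\<^sup>1) \<noteq> 1\<close>, where \<open>c\<close> is the conjugate of \<open>a\<close> by \<open>y\<close>, is not fixed by \<open>y\<close>.\<close>

lemma (in group) has_irr_character_of_prime_degree:
  assumes fin: "finite (carrier G)" and prime: "Factorial_Ring.prime p"
    and A: "A \<lhd> G" and index: "card (rcosets A) = p"
    and comm: "\<And>a b. a \<in> A \<Longrightarrow> b \<in> A \<Longrightarrow> a \<otimes> b = b \<otimes> a"
    and y: "y \<in> carrier G" "y \<notin> A" and a: "a \<in> A" "a \<otimes> y \<noteq> y \<otimes> a"
  shows "has_irr_character_of_degree G p"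
proof -
  interpret A: normal A G by (rule A)
  interpret GA: comm_group "G\<lparr>carrier := A\<rparr>"
    using subgroup_imp_group[OF A.subgroup_axioms] comm
    by (intro group.group_comm_groupI) auto
  define c where "c = inv y \<otimes> a \<otimes> y"
  have c: "c \<in> A" unfolding c_def using A.inv_op_closed1 y a by blast
  have "c \<otimes> inv a \<noteq> \<one>"
  proof
    assume "c \<otimes> inv a = \<one>"
    then have "c = a" using c a by (metis A.mem_carrier inv_equality inv_inv inv_closed)
    then have "y \<otimes> a = y \<otimes> (inv y \<otimes> a \<otimes> y)" by (simp add: c_def)
    also have "\<dots> = a \<otimes> y" using y a by (simp add: m_assoc[symmetric])
    finally show False using a by simp
  qed
  moreover have "finite A" using fin A.subset by (rule finite_subset[rotated])
  ultimately obtain \<chi> where \<chi>: "linear_character_on (G\<lparr>carrier := A\<rparr>) A \<chi>" "\<chi> (c \<otimes> inv a) \<noteq> 1"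
    using GA.linear_character_separates[of "c \<otimes> inv a"] c a by auto
  have \<chi>G: "linear_character_on G A \<chi>"
    using \<chi>(1) by (simp add: linear_character_on_def)
  interpret induced_character G A \<chi> y p
    by unfold_locales (use A index prime y \<chi>G in auto)
  have "\<chi> (c \<otimes> inv a) * \<chi> a = \<chi> c"
    using \<chi>_mult[of "c \<otimes> inv a" a] a c by (simp add: m_assoc)
  then have "\<chi> (conj_y 1 a) \<noteq> \<chi> a"
    using \<chi>(2) \<chi>_nonzero[OF a(1)] y by (auto simp: conj_y_def c_def)
  from irreducible_induced_matrix[OF a(1) this] show ?thesis
    by (rule has_irr_character_of_degreeI[OF is_group])
qed

lemma has_irr_character_of_degree_inflate:
  assumes "group_hom G X \<phi>" and surj: "\<phi> ` carrier G = carrier X"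
    and X: "has_irr_character_of_degree X d"
  shows "has_irr_character_of_degree G d"
proof -
  interpret group_hom G X \<phi> by fact
  obtain n \<rho> where \<rho>: "irreducible_representation X n \<rho>"
    and deg: "mat_trace (\<rho> \<one>\<^bsub>X\<^esub>) = of_nat d"
    using X unfolding has_irr_character_of_degree_def irr_characters_def char_degree_def by auto
  have "representation G n (\<rho> \<circ> \<phi>)"
    using \<rho> unfolding irreducible_representation_def representation_def
    by (auto simp: hom_def)
  then have "irreducible_representation G n (\<rho> \<circ> \<phi>)"
    using \<rho> unfolding irreducible_representation_def by (simp flip: surj)
  then have "(\<lambda>g\<in>carrier G. mat_trace ((\<rho> \<circ> \<phi>) g)) \<in> irr_characters G"
    unfolding irr_characters_def by blast
  then show ?thesis
    unfolding has_irr_character_of_degree_def char_degree_def using deg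
    by (intro bexI[of _ "\<lambda>g\<in>carrier G. mat_trace ((\<rho> \<circ> \<phi>) g)"]) simp_all
qed

section \<open>Actions of p-groups\<close>

lemma card_le_fibres:
  assumes "finite S" and "\<And>x. x \<in> S \<Longrightarrow> card {z \<in> S. f z = f x} \<le> c"
  shows "card S \<le> card (f ` S) * c"
proof -
  have "card S = card (\<Union>v\<in>f ` S. {z \<in> S. f z = v})"
    by (rule arg_cong[of _ _ card]) auto
  also have "\<dots> \<le> (\<Sum>v\<in>f ` S. card {z \<in> S. f z = v})"
    using assms(1) by (intro card_UN_le) simp
  also have "\<dots> \<le> (\<Sum>v\<in>f ` S. c)"
    using assms(2) by (intro sum_mono) auto
  finally show ?thesis by simp
qed

lemma group_actionI:
  assumes "group G"
    and closed: "\<And>g x. g \<in> carrier G \<Longrightarrow> x \<in> E \<Longrightarrow> act g x \<in> E"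
    and one: "\<And>x. x \<in> E \<Longrightarrow> act \<one>\<^bsub>G\<^esub> x = x"
    and mult: "\<And>g h x. g \<in> carrier G \<Longrightarrow> h \<in> carrier G \<Longrightarrow> x \<in> E \<Longrightarrow>
                 act (g \<otimes>\<^bsub>G\<^esub> h) x = act g (act h x)"
  shows "group_action G E (\<lambda>g. restrict (act g) E)"
proof -
  interpret G: group G by fact
  have bij: "restrict (act g) E \<in> Bij E" if g: "g \<in> carrier G" for g
  proof -
    have "bij_betw (act g) E E"
    proof (rule bij_betw_byWitness[where f' = "act (inv\<^bsub>G\<^esub> g)"])
      show "\<forall>x\<in>E. act (inv\<^bsub>G\<^esub> g) (act g x) = x"
        using g one by (simp flip: mult)
      show "\<forall>x\<in>E. act g (act (inv\<^bsub>G\<^esub> g) x) = x"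
        using g one by (simp flip: mult)
    qed (use g closed in auto)
    then show ?thesis by (simp add: Bij_def bij_betw_restrict_eq)
  qed
  have "restrict (act (g \<otimes>\<^bsub>G\<^esub> h)) E = compose E (restrict (act g) E) (restrict (act h) E)"
    if "g \<in> carrier G" "h \<in> carrier G" for g h
    using that closed mult by (auto simp: compose_def fun_eq_iff)
  then have "(\<lambda>g. restrict (act g) E) \<in> hom G (BijGroup E)"
    using bij by (auto simp: hom_def BijGroup_def)
  then show ?thesis
    by (simp add: group_action_def group_hom_def group_hom_axioms_def group_BijGroup assms(1))
qed

text \<open>The length of an orbit divides \<open>p\<^sup>k\<close>, so an orbit whose length is not divisible by \<open>p\<close> is a single fixed point.\<close>

lemma (in group_action) prime_dvd_card_fixed_points:
  assumes p: "Factorial_Ring.prime (p::nat)" and ord: "Coset.order G = p ^ k"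
    and fin: "finite E" and dvd: "p dvd card E"
  shows "p dvd card {x \<in> E. \<forall>g\<in>carrier G. \<phi> g x = x}"
proof -
  interpret group_hom G "BijGroup E" \<phi> by (rule group_hom)
  define F where "F = {x \<in> E. \<forall>g\<in>carrier G. \<phi> g x = x}"
  define S where "S = {B \<in> orbits G E \<phi>. \<not> p dvd card B}"
  have fin_orbits: "finite (orbits G E \<phi>)"
    using fin by (simp add: orbits_def)
  have S_eq: "S = (\<lambda>x. {x}) ` F"
  proof (intro equalityI subsetI)
    fix B assume "B \<in> S"
    then obtain x where x: "x \<in> E" "B = orbit G \<phi> x" "\<not> p dvd card B"
      by (auto simp: S_def orbits_def)
    then have "card B dvd p ^ k"
      using orbit_stabilizer_theorem[OF x(1)] ord by (metis dvd_triv_left)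
    then obtain i where "card B = p ^ i"
      using p divides_primepow_nat by blast
    with x(3) have "card B = 1" by (cases i) auto
    then obtain z where z: "B = {z}" by (auto simp: card_1_singleton_iff)
    have "x \<in> B" using orbit_refl[OF x(1)] x(2) by simp
    with z have B: "B = {x}" by simp
    have "\<phi> g x = x" if "g \<in> carrier G" for g
    proof -
      have "\<phi> g x \<in> B" using that x(2) by (auto simp: orbit_def)
      with B show ?thesis by simp
    qed
    then show "B \<in> (\<lambda>x. {x}) ` F" using B x(1) by (auto simp: F_def)
  next
    fix B assume "B \<in> (\<lambda>x. {x}) ` F"
    then obtain x where x: "x \<in> E" "\<And>g. g \<in> carrier G \<Longrightarrow> \<phi> g x = x" "B = {x}"
      by (auto simp: F_def)
    have "orbit G \<phi> x = (\<lambda>g. \<phi> g x) ` carrier G" by (auto simp: orbit_def)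
    also have "\<dots> = (\<lambda>g. x) ` carrier G" using x(2) by (rule image_cong[OF refl])
    also have "\<dots> = {x}" using G.one_closed by auto
    finally have "orbit G \<phi> x = {x}" .
    moreover have "\<not> p dvd 1" using p by auto
    ultimately show "B \<in> S" using x by (auto simp: S_def orbits_def)
  qed
  have "card E = (\<Sum>B\<in>orbits G E \<phi>. card B)"
    using disjoint_sum[OF fin, of "\<lambda>_. 1::nat"] by simp
  also have "\<dots> = (\<Sum>B\<in>orbits G E \<phi> - S. card B) + (\<Sum>B\<in>S. card B)"
    using fin_orbits by (intro sum.subset_diff) (auto simp: S_def)
  also have "(\<Sum>B\<in>S. card B) = card F"
    unfolding S_eq by (subst sum.reindex) (auto simp: inj_on_def)
  finally have "card E = (\<Sum>B\<in>orbits G E \<phi> - S. card B) + card F" .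
  moreover have "p dvd (\<Sum>B\<in>orbits G E \<phi> - S. card B)"
    by (rule dvd_sum) (auto simp: S_def)
  ultimately have "p dvd card F" using dvd by (metis dvd_add_right_iff)
  then show ?thesis by (simp add: F_def)
qed

section \<open>Commutators and relative centralizers\<close>

definition center :: "('a, 'b) monoid_scheme \<Rightarrow> 'a set" where
  "center G = {z \<in> carrier G. \<forall>g\<in>carrier G. g \<otimes>\<^bsub>G\<^esub> z = z \<otimes>\<^bsub>G\<^esub> g}"

text \<open>For normal \<open>N\<close> this is the preimage of the centralizer of \<open>S N/N\<close> in \<open>G/N\<close>.  Working with the preimage
avoids passing to a quotient of a quotient.\<close>

definition centralizer_mod ::
  "('a, 'b) monoid_scheme \<Rightarrow> 'a set \<Rightarrow> 'a set \<Rightarrow> 'a set" where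
  "centralizer_mod G N S = {g \<in> carrier G. \<forall>s\<in>S. g \<otimes>\<^bsub>G\<^esub> s \<otimes>\<^bsub>G\<^esub> inv\<^bsub>G\<^esub> g \<otimes>\<^bsub>G\<^esub> inv\<^bsub>G\<^esub> s \<in> N}"

lemma (in group) commutator_eq_one_iff:
  assumes "x \<in> carrier G" "z \<in> carrier G"
  shows "x \<otimes> z \<otimes> inv x \<otimes> inv z = \<one> \<longleftrightarrow> x \<otimes> z = z \<otimes> x"
proof -
  have "x \<otimes> z \<otimes> inv x \<otimes> inv z = \<one> \<longleftrightarrow> x \<otimes> z \<otimes> inv x = z"
    using assms inv_solve_right[of "\<one>" "x \<otimes> z \<otimes> inv x" z] by auto
  also have "\<dots> \<longleftrightarrow> x \<otimes> z = z \<otimes> x"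
    using assms inv_solve_right[of z "x \<otimes> z" x] by auto
  finally show ?thesis .
qed

lemma (in group) mult_inv_cancel:
  assumes "x \<in> carrier G" "z \<in> carrier G"
  shows "x \<otimes> (inv x \<otimes> z) = z" and "inv x \<otimes> (x \<otimes> z) = z"
  using assms by (simp_all add: m_assoc[symmetric])

lemma (in group) commutator_eq_one:
  assumes "x \<in> carrier G" "z \<in> carrier G" "x \<otimes> z = z \<otimes> x"
  shows "x \<otimes> z \<otimes> inv x \<otimes> inv z = \<one>"
  using commutator_eq_one_iff[OF assms(1,2)] assms(3) by (rule iffD2)

text \<open>The form in which commutativity of a quotient is used below.\<close>

lemma (in group_hom) image_commute:
  assumes "x \<in> carrier G" "z \<in> carrier G" "h (x \<otimes> z \<otimes> inv x \<otimes> inv z) = \<one>\<^bsub>H\<^esub>"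
  shows "h x \<otimes>\<^bsub>H\<^esub> h z = h z \<otimes>\<^bsub>H\<^esub> h x"
  using assms H.commutator_eq_one_iff[of "h x" "h z"] by simp

lemma (in group) inv_commutator:
  assumes "x \<in> carrier G" "z \<in> carrier G"
  shows "inv (x \<otimes> z \<otimes> inv x \<otimes> inv z) = z \<otimes> x \<otimes> inv z \<otimes> inv x"
  using assms by (simp add: inv_mult_group m_assoc)

lemma (in group) commutator_in_derived:
  assumes "x \<in> S" "z \<in> S"
  shows "x \<otimes> z \<otimes> inv x \<otimes> inv z \<in> derived G S"
  unfolding derived_def using assms by (intro generate.incl) blast

lemma (in group) derived_subsetI:
  assumes "subgroup N G"
    and "\<And>x z. x \<in> S \<Longrightarrow> z \<in> S \<Longrightarrow> x \<otimes> z \<otimes> inv x \<otimes> inv z \<in> N"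
  shows "derived G S \<subseteq> N"
  unfolding derived_def by (rule generate_subgroup_incl) (use assms in auto)

lemma (in group) subgroup_centralizer_mod:
  assumes "N \<lhd> G" and S: "S \<subseteq> carrier G"
  shows "subgroup (centralizer_mod G N S) G"
proof -
  interpret N: normal N G by fact
  show ?thesis
  proof (rule subgroupI)
    show "centralizer_mod G N S \<subseteq> carrier G" by (auto simp: centralizer_mod_def)
    have "\<one> \<in> centralizer_mod G N S"
      using S by (auto simp: centralizer_mod_def)
    then show "centralizer_mod G N S \<noteq> {}" by blast
    fix g assume g: "g \<in> centralizer_mod G N S"
    then have gG: "g \<in> carrier G" by (simp add: centralizer_mod_def)
    show "inv g \<in> centralizer_mod G N S"
      unfolding centralizer_mod_def
    proof (intro CollectI conjI ballI)
      fix s assume s: "s \<in> S"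
      then have sG: "s \<in> carrier G" using S by auto
      \<comment> \<open>the identity \<open>[g\<^sup>-\<^sup>1, s] = g\<^sup>-\<^sup>1 [g, s]\<^sup>-\<^sup>1 g\<close>\<close>
      have "inv g \<otimes> inv (g \<otimes> s \<otimes> inv g \<otimes> inv s) \<otimes> g \<in> N"
        using g s gG by (intro N.inv_op_closed1) (auto simp: centralizer_mod_def)
      also have "inv g \<otimes> inv (g \<otimes> s \<otimes> inv g \<otimes> inv s) \<otimes> g =
          inv g \<otimes> s \<otimes> inv (inv g) \<otimes> inv s"
        unfolding inv_commutator[OF gG sG] using gG sG by (simp add: m_assoc)
      finally show "inv g \<otimes> s \<otimes> inv (inv g) \<otimes> inv s \<in> N" .
    qed (use gG in simp)
    fix h assume h: "h \<in> centralizer_mod G N S"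
    then have hG: "h \<in> carrier G" by (simp add: centralizer_mod_def)
    show "g \<otimes> h \<in> centralizer_mod G N S"
      unfolding centralizer_mod_def
    proof (intro CollectI conjI ballI)
      fix s assume s: "s \<in> S"
      then have sG: "s \<in> carrier G" using S by auto
      \<comment> \<open>the identity \<open>[g h, s] = (g [h, s] g\<^sup>-\<^sup>1) [g, s]\<close>\<close>
      have "g \<otimes> (h \<otimes> s \<otimes> inv h \<otimes> inv s) \<otimes> inv g \<in> N"
        using h s gG by (intro N.inv_op_closed2) (auto simp: centralizer_mod_def)
      moreover have "g \<otimes> s \<otimes> inv g \<otimes> inv s \<in> N"
        using g s by (simp add: centralizer_mod_def)
      ultimately have "(g \<otimes> (h \<otimes> s \<otimes> inv h \<otimes> inv s) \<otimes> inv g) \<otimes> (g \<otimes> s \<otimes> inv g \<otimes> inv s) \<in> N"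
        by (rule N.m_closed)
      also have "(g \<otimes> (h \<otimes> s \<otimes> inv h \<otimes> inv s) \<otimes> inv g) \<otimes> (g \<otimes> s \<otimes> inv g \<otimes> inv s) =
          g \<otimes> h \<otimes> s \<otimes> inv h \<otimes> (inv s \<otimes> ((inv g \<otimes> g) \<otimes> s)) \<otimes> inv g \<otimes> inv s"
        using gG hG sG by (simp add: m_assoc del: l_inv Units_l_inv)
      also have "\<dots> = (g \<otimes> h) \<otimes> s \<otimes> inv (g \<otimes> h) \<otimes> inv s"
        using gG hG sG by (simp add: inv_mult_group m_assoc)
      finally show "(g \<otimes> h) \<otimes> s \<otimes> inv (g \<otimes> h) \<otimes> inv s \<in> N" .
    qed (use gG hG in simp)
  qed
qed

text \<open>Modulo \<open>N\<close>, the maximal subgroup \<open>A\<close> is abelian and commutes with an element \<open>y\<close> outside it.  The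
centralizers (modulo \<open>N\<close>) of \<open>A\<close>, of \<open>y\<close> and finally of \<open>G\<close> contain \<open>A\<close> and \<open>y\<close>, so by maximality each
of them is \<open>G\<close>.\<close>

lemma (in group) derived_subset_of_maximal_subgroup:
  assumes N: "N \<lhd> G" and A: "maximal_subgroup A G"
    and AA: "\<And>a b. a \<in> A \<Longrightarrow> b \<in> A \<Longrightarrow> a \<otimes> b \<otimes> inv a \<otimes> inv b \<in> N"
    and y: "y \<in> carrier G" "y \<notin> A"
    and Ay: "\<And>a. a \<in> A \<Longrightarrow> a \<otimes> y \<otimes> inv a \<otimes> inv y \<in> N"
  shows "derived G (carrier G) \<subseteq> N"
proof -
  interpret N: normal N G by (rule N)
  have sub_A: "subgroup A G" using A by (simp add: maximal_subgroup_def)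
  then have A_sub: "A \<subseteq> carrier G" by (rule subgroup.subset)
  have all: "K = carrier G" if "subgroup K G" "A \<subseteq> K" "y \<in> K" for K
    using A y that unfolding maximal_subgroup_def by blast
  have swap: "z \<otimes> x \<otimes> inv z \<otimes> inv x \<in> N"
    if "x \<otimes> z \<otimes> inv x \<otimes> inv z \<in> N" "x \<in> carrier G" "z \<in> carrier G" for x z
    using that inv_commutator N.m_inv_closed by metis
  have yA: "y \<otimes> a \<otimes> inv y \<otimes> inv a \<in> N" if "a \<in> A" for a
    using swap[OF Ay[OF that]] that y A_sub by blast
  have yy: "y \<otimes> y \<otimes> inv y \<otimes> inv y \<in> N" using y by (simp add: m_assoc)
  have "centralizer_mod G N A = carrier G"
    by (rule all[OF subgroup_centralizer_mod[OF N A_sub]])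
       (use AA yA y A_sub in \<open>auto simp: centralizer_mod_def\<close>)
  then have gA: "g \<otimes> a \<otimes> inv g \<otimes> inv a \<in> N" if "g \<in> carrier G" "a \<in> A" for g a
    using that by (auto simp: centralizer_mod_def)
  have "centralizer_mod G N {y} = carrier G"
    by (rule all[OF subgroup_centralizer_mod[OF N]])
       (use Ay yy y A_sub in \<open>auto simp: centralizer_mod_def\<close>)
  then have gy: "g \<otimes> y \<otimes> inv g \<otimes> inv y \<in> N" if "g \<in> carrier G" for g
    using that by (auto simp: centralizer_mod_def)
  have "centralizer_mod G N (carrier G) = carrier G"
    by (rule all[OF subgroup_centralizer_mod[OF N]])
       (use swap[OF gA] swap[OF gy] y A_sub in \<open>auto simp: centralizer_mod_def\<close>)
  then show ?thesis
    by (intro derived_subsetI[OF N.subgroup_axioms]) (auto simp: centralizer_mod_def)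
qed

lemma (in group) center_eq_centralizer_mod: "center G = centralizer_mod G {\<one>} (carrier G)"
  unfolding center_def centralizer_mod_def using commutator_eq_one_iff by auto

lemma (in group) subgroup_center: "subgroup (center G) G"
  unfolding center_eq_centralizer_mod
  by (rule subgroup_centralizer_mod[OF one_is_normal]) simp

section \<open>Maximal subgroups of p-groups\<close>

lemma (in group) center_nontrivial:
  assumes p: "Factorial_Ring.prime (p::nat)" and ord: "Coset.order G = p ^ k" "0 < k"
  shows "center G \<noteq> {\<one>}"
proof -
  have fin: "finite (carrier G)"
    using ord(1) p by (metis order_gt_0_iff_finite prime_gt_0_nat zero_less_power)
  interpret act: group_action G "carrier G" "\<lambda>g. \<lambda>h\<in>carrier G. g \<otimes> h \<otimes> inv g"
    by (rule action_by_conjugation)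
  have "p dvd card (carrier G)" using ord by (auto simp: Coset.order_def)
  then have "p dvd card {x \<in> carrier G. \<forall>g\<in>carrier G. (\<lambda>h\<in>carrier G. g \<otimes> h \<otimes> inv g) x = x}"
    by (rule act.prime_dvd_card_fixed_points[OF p ord(1) fin])
  also have "{x \<in> carrier G. \<forall>g\<in>carrier G. (\<lambda>h\<in>carrier G. g \<otimes> h \<otimes> inv g) x = x} = center G"
  proof -
    have "g \<otimes> x \<otimes> inv g = x \<longleftrightarrow> g \<otimes> x = x \<otimes> g"
      if "x \<in> carrier G" "g \<in> carrier G" for x g
      using that inv_solve_right[of x "g \<otimes> x" g] by auto
    then show ?thesis by (auto simp: center_def)
  qed
  finally have "p dvd card (center G)" .
  then show ?thesis using p by auto
qed

lemma (in group) prime_mult_card_le_card: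
  assumes p: "Factorial_Ring.prime (p::nat)" and ord: "Coset.order G = p ^ k"
    and K: "subgroup K G" and L: "subgroup L G" and less: "K \<subset> L"
  shows "p * card K \<le> card L"
proof -
  have fin: "finite (carrier G)"
    using ord p by (metis order_gt_0_iff_finite prime_gt_0_nat zero_less_power)
  then have finL: "finite L" using subgroup.subset[OF L] finite_subset by blast
  have "subgroup K (G\<lparr>carrier := L\<rparr>)"
    using subgroup_incl[OF K L] less by blast
  then have lag: "card (rcosets\<^bsub>G\<lparr>carrier := L\<rparr>\<^esub> K) * card K = card L"
    using group.lagrange[OF subgroup_imp_group[OF L]] by (simp add: Coset.order_def)
  define c where "c = card (rcosets\<^bsub>G\<lparr>carrier := L\<rparr>\<^esub> K)"
  have "card L dvd p ^ k"
    using lagrange[OF L] ord by (metis dvd_triv_right)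
  then have "c dvd p ^ k" using lag c_def by (metis dvd_mult_left)
  then obtain i where i: "c = p ^ i" using divides_primepow_nat[OF p] by blast
  have "card K < card L" using less finL by (rule psubset_card_mono[rotated])
  then have "i \<noteq> 0" using lag i unfolding c_def by (intro notI) simp
  then have "p \<le> c" unfolding i using p self_le_power[of p i] prime_ge_1_nat by simp
  then show ?thesis using lag unfolding c_def by (metis mult_le_mono1)
qed

lemma (in group_hom) subgroup_preimage:
  assumes "subgroup K H"
  shows "subgroup {x \<in> carrier G. h x \<in> K} G"
  using assms by (intro G.subgroupI) (auto simp: subgroup_def)

text \<open>\<open>M\<close> acts on its cosets by right multiplication and fixes the coset \<open>M\<close>.  The number of cosets is a
nontrivial power of \<open>p\<close>, so there is another fixed coset \<open>M g\<close>; then \<open>g\<close> normalizes \<open>M\<close>, and the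
normalizer of \<open>M\<close> is larger than \<open>M\<close>, hence is \<open>G\<close>.\<close>

lemma (in group) maximal_subgroup_normal:
  assumes p: "Factorial_Ring.prime (p::nat)" and ord: "Coset.order G = p ^ k"
    and M: "maximal_subgroup M G"
  shows "M \<lhd> G"
proof -
  have fin: "finite (carrier G)"
    using ord p by (metis order_gt_0_iff_finite prime_gt_0_nat zero_less_power)
  have sub: "subgroup M G" and neq: "M \<noteq> carrier G"
    using M by (auto simp: maximal_subgroup_def)
  interpret M: subgroup M G by (rule sub)
  interpret GM: group "G\<lparr>carrier := M\<rparr>" by (rule subgroup_imp_group[OF sub])
  have finM: "finite M" using fin M.subset finite_subset by blast
  interpret act: group_action "G\<lparr>carrier := M\<rparr>" "rcosets M" "\<lambda>m. \<lambda>C\<in>rcosets M. C #> inv m"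
  proof (rule group_actionI)
    show "C #> inv m \<in> rcosets M" if "m \<in> carrier (G\<lparr>carrier := M\<rparr>)" "C \<in> rcosets M" for m C
      using that by (auto simp: RCOSETS_def coset_mult_assoc M.subset)
    show "C #> inv \<one>\<^bsub>G\<lparr>carrier := M\<rparr>\<^esub> = C" if "C \<in> rcosets M" for C
      using that M.rcosets_carrier[OF is_group] by simp
    show "C #> inv (m \<otimes>\<^bsub>G\<lparr>carrier := M\<rparr>\<^esub> n) = C #> inv n #> inv m"
      if "m \<in> carrier (G\<lparr>carrier := M\<rparr>)" "n \<in> carrier (G\<lparr>carrier := M\<rparr>)" "C \<in> rcosets M"
      for m n C
      using that M.rcosets_carrier[OF is_group that(3)]
      by (simp add: inv_mult_group coset_mult_assoc)
  qed (rule GM.is_group)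
  have "card M dvd p ^ k" using lagrange[OF sub] ord by (metis dvd_triv_right)
  then obtain i where i: "card M = p ^ i" using divides_primepow_nat[OF p] by blast
  have "card (rcosets M) dvd p ^ k" using lagrange[OF sub] ord by (metis dvd_triv_left)
  then obtain j where j: "card (rcosets M) = p ^ j" using divides_primepow_nat[OF p] by blast
  have "j \<noteq> 0"
  proof
    assume "j = 0"
    then have "card M = card (carrier G)" using lagrange[OF sub] j by (simp add: Coset.order_def)
    then show False using neq card_subset_eq[OF fin M.subset] by blast
  qed
  define F where
    "F = {C \<in> rcosets M. \<forall>m\<in>carrier (G\<lparr>carrier := M\<rparr>). (\<lambda>C\<in>rcosets M. C #> inv m) C = C}"
  have "p dvd card F"
    unfolding F_def
  proof (rule act.prime_dvd_card_fixed_points[OF p])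
    show "Coset.order (G\<lparr>carrier := M\<rparr>) = p ^ i" using i by (simp add: Coset.order_def)
    show "finite (rcosets M)" using j p by (metis card.infinite power_not_zero not_prime_0)
    show "p dvd card (rcosets M)" using j \<open>j \<noteq> 0\<close> by simp
  qed
  moreover have "M \<in> F"
    unfolding F_def using M.subgroup_in_rcosets[OF is_group] coset_join2[OF _ sub] by auto
  ultimately have "F \<noteq> {M}" using p by auto
  with \<open>M \<in> F\<close> obtain C where C: "C \<in> F" "C \<noteq> M" by blast
  then obtain g where g: "g \<in> carrier G" "C = M #> g" by (auto simp: F_def RCOSETS_def)
  have "g \<notin> M" using C(2) g coset_join2[OF _ sub] by blast
  have conj_inv: "g \<otimes> inv m \<otimes> inv g \<in> M" if m: "m \<in> M" for m
  proof -
    have "M #> g #> inv m = M #> g" using C(1) m unfolding g(2) F_def by auto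
    then have "M #> (g \<otimes> inv m) = M #> g" using g m by (simp add: coset_mult_assoc M.subset)
    then have "g \<otimes> inv m \<in> M #> g"
      using rcos_self[OF _ sub, of "g \<otimes> inv m"] g m by simp
    then show ?thesis using M.rcos_module_imp[OF is_group g(1)] by simp
  qed
  \<comment> \<open>the normalizer of \<open>M\<close>; since \<open>M\<close> is finite, an element that conjugates \<open>M\<close> into itself belongs to it\<close>
  define N where "N = {x \<in> carrier G. (\<lambda>m. x \<otimes> m \<otimes> inv x) ` M = M}"
  have N_iff: "x \<in> N" if x: "x \<in> carrier G" and "\<And>m. m \<in> M \<Longrightarrow> x \<otimes> m \<otimes> inv x \<in> M" for x
  proof -
    have "inj_on (\<lambda>m. x \<otimes> m \<otimes> inv x) M" using x M.mem_carrier by (auto simp: inj_on_def)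
    moreover have "(\<lambda>m. x \<otimes> m \<otimes> inv x) ` M \<subseteq> M" using that(2) by auto
    ultimately show ?thesis unfolding N_def using x endo_inj_surj[OF finM] by simp
  qed
  have subN: "subgroup N G"
  proof (rule subgroupI)
    show "N \<subseteq> carrier G" by (auto simp: N_def)
    show "N \<noteq> {}" using N_iff[of \<one>] by auto
    fix x assume x: "x \<in> N"
    show "inv x \<in> N"
    proof (rule N_iff)
      fix m assume "m \<in> M"
      then obtain n where n: "n \<in> M" "m = x \<otimes> n \<otimes> inv x" using x by (auto simp: N_def)
      then have "inv x \<otimes> m \<otimes> inv (inv x) = n"
        using x by (simp add: N_def m_assoc) (simp add: m_assoc[symmetric])
      then show "inv x \<otimes> m \<otimes> inv (inv x) \<in> M" using n by simp
    qed (use x in \<open>simp add: N_def\<close>)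
    fix z assume z: "z \<in> N"
    show "x \<otimes> z \<in> N"
    proof (rule N_iff)
      fix m assume m: "m \<in> M"
      have "z \<otimes> m \<otimes> inv z \<in> M" using z m by (auto simp: N_def)
      then have "x \<otimes> (z \<otimes> m \<otimes> inv z) \<otimes> inv x \<in> M" using x by (auto simp: N_def)
      also have "x \<otimes> (z \<otimes> m \<otimes> inv z) \<otimes> inv x = x \<otimes> z \<otimes> m \<otimes> inv (x \<otimes> z)"
        using x z m by (simp add: N_def m_assoc inv_mult_group)
      finally show "x \<otimes> z \<otimes> m \<otimes> inv (x \<otimes> z) \<in> M" .
    qed (use x z in \<open>simp add: N_def\<close>)
  qed
  have "M \<subseteq> N" by (intro subsetI N_iff) auto
  moreover have "g \<in> N"
    using conj_inv[OF M.m_inv_closed] by (intro N_iff[OF g(1)]) simp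
  ultimately have "N = carrier G"
    using M subN \<open>g \<notin> M\<close> unfolding maximal_subgroup_def by blast
  then show ?thesis
    unfolding normal_inv_iff using sub by (auto simp: N_def)
qed

text \<open>The preimage of a subgroup of order \<open>p\<close> of \<open>G/M\<close> properly contains \<open>M\<close>, hence is \<open>G\<close>.\<close>

lemma (in group) maximal_subgroup_index:
  assumes p: "Factorial_Ring.prime (p::nat)" and ord: "Coset.order G = p ^ k"
    and M: "maximal_subgroup M G"
  shows "card (rcosets M) = p"
proof -
  have fin: "finite (carrier G)"
    using ord p by (metis order_gt_0_iff_finite prime_gt_0_nat zero_less_power)
  interpret M: normal M G by (rule maximal_subgroup_normal[OF assms])
  interpret Q: group "G Mod M" by (rule M.factorgroup_is_group)
  interpret \<pi>: group_hom G "G Mod M" "\<lambda>x. M #> x"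
    by (simp add: group_hom_def group_hom_axioms_def is_group Q.is_group M.r_coset_hom_Mod)
  have ordQ: "Coset.order (G Mod M) = card (rcosets M)"
    by (simp add: Coset.order_def FactGroup_def)
  have neq: "M \<noteq> carrier G" using M by (simp add: maximal_subgroup_def)
  have "card (rcosets M) dvd p ^ k"
    using lagrange[OF M.subgroup_axioms] ord by (metis dvd_triv_left)
  then obtain j where j: "card (rcosets M) = p ^ j" using divides_primepow_nat[OF p] by blast
  have "j \<noteq> 0"
  proof
    assume "j = 0"
    then have "card M = card (carrier G)"
      using lagrange[OF M.subgroup_axioms] j by (simp add: Coset.order_def)
    then show False using neq card_subset_eq[OF fin M.subset] by blast
  qed
  then obtain i where "j = Suc i" by (cases j) auto
  then have "Coset.order (G Mod M) = p ^ 1 * p ^ i" using j ordQ by simp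
  then obtain P where P: "subgroup P (G Mod M)" "card P = p ^ 1"
    using sylow_thm[OF p Q.is_group] j p ordQ
    by (metis Q.order_gt_0_iff_finite prime_gt_0_nat zero_less_power)
  define K where "K = {x \<in> carrier G. M #> x \<in> P}"
  have K: "subgroup K G" unfolding K_def by (rule \<pi>.subgroup_preimage[OF P(1)])
  have "M \<in> P" using subgroup.one_closed[OF P(1)] by simp
  then have "M \<subseteq> K"
    unfolding K_def using coset_join2[OF _ M.subgroup_axioms] by auto
  have P_sub: "P \<subseteq> (\<lambda>x. M #> x) ` K"
    using subgroup.subset[OF P(1)] unfolding K_def carrier_FactGroup by blast
  have "K \<noteq> M"
  proof
    assume "K = M"
    then have "P \<subseteq> {M}" using P_sub coset_join2[OF _ M.subgroup_axioms] by auto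
    then have "card P \<le> 1" using card_mono[of "{M}" P] by simp
    then show False using P(2) prime_gt_1_nat[OF p] by simp
  qed
  then have "K = carrier G" using M K \<open>M \<subseteq> K\<close> unfolding maximal_subgroup_def by blast
  then have "P = rcosets M"
    using subgroup.subset[OF P(1)] unfolding K_def by (auto simp: FactGroup_def RCOSETS_def)
  then show ?thesis using P(2) by simp
qed

lemma (in group) prime_index_imp_maximal:
  assumes fin: "finite (carrier G)" and A: "subgroup A G"
    and p: "Factorial_Ring.prime (p::nat)" and index: "card (rcosets A) = p"
  shows "maximal_subgroup A G"
  unfolding maximal_subgroup_def
proof (intro conjI allI impI)
  have lagA: "p * card A = card (carrier G)"
    using lagrange[OF A] index by (simp add: Coset.order_def)
  have A0: "0 < card A"
    using fin subgroup.subset[OF A] finite_subset subgroup.one_closed[OF A] card_gt_0_iff by blast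
  show "A \<noteq> carrier G" using lagA A0 prime_gt_1_nat[OF p] by auto
  fix K assume K: "subgroup K G" and "A \<subseteq> K"
  have finK: "finite K" using fin subgroup.subset[OF K] finite_subset by blast
  have "subgroup A (G\<lparr>carrier := K\<rparr>)" using subgroup_incl[OF A K \<open>A \<subseteq> K\<close>] .
  then have lagK: "card (rcosets\<^bsub>G\<lparr>carrier := K\<rparr>\<^esub> A) * card A = card K"
    using group.lagrange[OF subgroup_imp_group[OF K]] by (simp add: Coset.order_def)
  define c where "c = card (rcosets\<^bsub>G\<lparr>carrier := K\<rparr>\<^esub> A)"
  have "card (rcosets K) * (c * card A) = p * card A"
    using lagrange[OF K] lagA lagK by (simp add: c_def Coset.order_def)
  then have "card (rcosets K) * c = p" using A0 by (simp add: mult.assoc[symmetric])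
  then have "c dvd p" by (metis dvd_triv_right)
  then consider "c = 1" | "c = p" using p prime_nat_iff by blast
  then show "K = A \<or> K = carrier G"
  proof cases
    case 1
    then have "card A = card K" using lagK by (simp add: c_def)
    then show ?thesis using card_subset_eq[OF finK \<open>A \<subseteq> K\<close>] by blast
  next
    case 2
    then have "card K = card (carrier G)" using lagK lagA by (simp add: c_def)
    then show ?thesis using card_subset_eq[OF fin subgroup.subset[OF K]] by blast
  qed
qed (rule A)

section \<open>Images in quotient groups\<close>

lemma (in normal) group_hom_r_coset: "group_hom G (G Mod H) (\<lambda>x. H #> x)"
  by (simp add: group_hom_def group_hom_axioms_def is_group factorgroup_is_group r_coset_hom_Mod)

lemma (in normal) r_coset_eq_self_iff: "x \<in> carrier G \<Longrightarrow> H #> x = H \<longleftrightarrow> x \<in> H"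
  using coset_join1[OF _ _ subgroup_axioms] coset_join2[OF _ subgroup_axioms] subset by metis

lemma (in normal) card_le_card_image_r_coset:
  assumes fin: "finite (carrier G)" and S: "S \<subseteq> carrier G"
  shows "card S \<le> card ((\<lambda>x. H #> x) ` S) * card H"
proof (rule card_le_fibres)
  show "finite S" using fin S finite_subset by blast
  fix x assume "x \<in> S"
  then have x: "x \<in> carrier G" using S by blast
  have "{z \<in> S. H #> z = H #> x} \<subseteq> H #> x"
    using rcos_self[OF _ subgroup_axioms] S by blast
  moreover have "finite (H #> x)"
    using r_coset_subset_G[OF subset x] fin finite_subset by blast
  ultimately have "card {z \<in> S. H #> z = H #> x} \<le> card (H #> x)" by (rule card_mono[rotated])
  also have "card (H #> x) = card H"
    using card_rcosets_equal[OF rcosetsI[OF subset x] subset] by simp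
  finally show "card {z \<in> S. H #> z = H #> x} \<le> card H" .
qed

lemma (in group) card_image_r_coset:
  assumes "N \<lhd> G" and S: "subgroup S G" and "N \<subseteq> S"
  shows "card ((\<lambda>x. N #> x) ` S) * card N = card S"
proof -
  interpret N: normal N G by fact
  have "subgroup N (G\<lparr>carrier := S\<rparr>)" using subgroup_incl[OF N.subgroup_axioms S \<open>N \<subseteq> S\<close>] .
  then have "card (rcosets\<^bsub>G\<lparr>carrier := S\<rparr>\<^esub> N) * card N = card S"
    using group.lagrange[OF subgroup_imp_group[OF S]] by (simp add: Coset.order_def)
  moreover have "rcosets\<^bsub>G\<lparr>carrier := S\<rparr>\<^esub> N = (\<lambda>x. N #> x) ` S"
    by (auto simp: RCOSETS_def)
  ultimately show ?thesis by simp
qed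

lemma (in group) card_subgroup_le_index_mult:
  assumes fin: "finite (carrier G)" and H: "subgroup H G" and M: "subgroup M G"
  shows "card H \<le> card (rcosets M) * card (H \<inter> M)"
proof -
  interpret H: subgroup H G by (rule H)
  interpret M: subgroup M G by (rule M)
  have finH: "finite H" using fin H.subset finite_subset by blast
  have "card H \<le> card ((\<lambda>x. M #> x) ` H) * card (H \<inter> M)"
  proof (rule card_le_fibres[OF finH])
    fix x assume x: "x \<in> H"
    have "{z \<in> H. M #> z = M #> x} \<subseteq> (\<lambda>m. m \<otimes> x) ` (H \<inter> M)"
    proof
      fix z assume "z \<in> {z \<in> H. M #> z = M #> x}"
      then have z: "z \<in> H" "M #> z = M #> x" by auto
      then have "z \<in> M #> x" using rcos_self[OF _ M, of z] by simp
      then have "z \<otimes> inv x \<in> M" using M.rcos_module_imp[OF is_group] x by simp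
      then have "z \<otimes> inv x \<in> H \<inter> M" using z x by simp
      moreover have "z = z \<otimes> inv x \<otimes> x" using z x by (simp add: m_assoc)
      ultimately show "z \<in> (\<lambda>m. m \<otimes> x) ` (H \<inter> M)" by (rule rev_image_eqI)
    qed
    then show "card {z \<in> H. M #> z = M #> x} \<le> card (H \<inter> M)"
      using surj_card_le[of "H \<inter> M"] finH by blast
  qed
  also have "card ((\<lambda>x. M #> x) ` H) \<le> card (rcosets M)"
  proof (rule card_mono)
    show "finite (rcosets M)"
      using fin by (simp add: RCOSETS_def)
    show "(\<lambda>x. M #> x) ` H \<subseteq> rcosets M" using H.subset unfolding RCOSETS_def by blast
  qed
  finally show ?thesis by simp
qed

lemma (in group_hom) maximal_subgroup_image:
  assumes surj: "h ` carrier G = carrier H" and ker: "kernel G H h \<subseteq> M"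
    and M: "maximal_subgroup M G"
  shows "maximal_subgroup (h ` M) H"
proof -
  have sub: "subgroup M G" using M by (simp add: maximal_subgroup_def)
  interpret M: subgroup M G by (rule sub)
  have mem: "x \<in> M" if "x \<in> carrier G" "h x \<in> h ` M" for x
  proof -
    obtain m where m: "m \<in> M" "h x = h m" using \<open>h x \<in> h ` M\<close> by blast
    then have "x \<otimes> inv m \<in> kernel G H h" using that(1) by (simp add: kernel_def)
    then have "x \<otimes> inv m \<otimes> m \<in> M" using ker m by blast
    then show ?thesis using that(1) m by (simp add: G.m_assoc)
  qed
  show ?thesis
    unfolding maximal_subgroup_def
  proof (intro conjI allI impI)
    show "subgroup (h ` M) H" by (rule subgroup_img_is_subgroup[OF sub])
    show "h ` M \<noteq> carrier H"
    proof
      assume "h ` M = carrier H"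
      then have "carrier G \<subseteq> M" using mem by auto
      then show False using M M.subset by (auto simp: maximal_subgroup_def)
    qed
    fix K assume K: "subgroup K H" "h ` M \<subseteq> K"
    define K' where "K' = {x \<in> carrier G. h x \<in> K}"
    have "subgroup K' G" unfolding K'_def by (rule subgroup_preimage[OF K(1)])
    moreover have "M \<subseteq> K'" using K(2) by (auto simp: K'_def)
    ultimately have "K' = M \<or> K' = carrier G" using M by (auto simp: maximal_subgroup_def)
    moreover have "K = h ` K'"
      using subgroup.subset[OF K(1)] unfolding K'_def by (auto simp flip: surj)
    ultimately show "K = h ` M \<or> K = carrier H" using surj by auto
  qed
qed

section \<open>Characters of degree p from a small abelianization\<close>

text \<open>An element \<open>y\<close> outside \<open>A\<close> cannot commute with all of \<open>A\<close>, because \<open>A\<close> is abelian and maximal.\<close>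

lemma (in group) nonabelian_has_irr_character_of_prime_degree:
  assumes fin: "finite (carrier G)" and p: "Factorial_Ring.prime p"
    and A: "A \<lhd> G" and index: "card (rcosets A) = p"
    and comm: "\<And>a b. a \<in> A \<Longrightarrow> b \<in> A \<Longrightarrow> a \<otimes> b = b \<otimes> a"
    and nonabelian: "\<not> derived G (carrier G) \<subseteq> {\<one>}"
  shows "has_irr_character_of_degree G p"
proof -
  interpret A: normal A G by (rule A)
  have max: "maximal_subgroup A G"
    by (rule prime_index_imp_maximal[OF fin A.subgroup_axioms p index])
  then obtain y where y: "y \<in> carrier G" "y \<notin> A"
    using A.subset unfolding maximal_subgroup_def by blast
  have "\<exists>a\<in>A. a \<otimes> y \<noteq> y \<otimes> a"
  proof (rule ccontr)
    assume "\<not> ?thesis"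
    then have ay: "a \<otimes> y = y \<otimes> a" if "a \<in> A" for a using that by blast
    have "derived G (carrier G) \<subseteq> {\<one>}"
    proof (rule derived_subset_of_maximal_subgroup[OF one_is_normal max _ y])
      fix a assume a: "a \<in> A"
      show "a \<otimes> y \<otimes> inv a \<otimes> inv y \<in> {\<one>}"
        unfolding singleton_iff
        by (rule commutator_eq_one[OF A.mem_carrier[OF a] y(1) ay[OF a]])
      fix b assume b: "b \<in> A"
      show "a \<otimes> b \<otimes> inv a \<otimes> inv b \<in> {\<one>}"
        unfolding singleton_iff
        by (rule commutator_eq_one[OF A.mem_carrier[OF a] A.mem_carrier[OF b] comm[OF a b]])
    qed
    then show False using nonabelian by blast
  qed
  then show ?thesis
    using has_irr_character_of_prime_degree[OF fin p A index comm y] by blast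
qed

text \<open>Let \<open>x\<close> be noncentral, with centralizer \<open>C\<close>.  The commutators with \<open>x\<close> lie in \<open>P\<close>, so \<open>C\<close> has index \<open>p\<close>.
If \<open>C\<close> contained noncommuting elements \<open>a\<close> and \<open>b\<close>, the chain
\<open>Z(G) < Z(C) < C\<^sub>C(a) < C < G\<close>, whose steps are strict because of \<open>x\<close>, \<open>a\<close>, \<open>b\<close> and \<open>y\<close>, would make the
order of \<open>G\<close> at least \<open>p^4 |Z(G)| \<ge> p^5\<close>.  So \<open>C\<close> is abelian.\<close>

lemma (in group) has_irr_character_of_central_derived:
  assumes p: "Factorial_Ring.prime p" and ord: "Coset.order G = p ^ k"
    and P: "subgroup P G" "card P = p" "P \<subseteq> center G" "derived G (carrier G) \<subseteq> P"
    and nonabelian: "\<not> derived G (carrier G) \<subseteq> {\<one>}"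
    and small: "Coset.order G \<le> p ^ 4"
  shows "has_irr_character_of_degree G p"
proof -
  have fin: "finite (carrier G)"
    using ord p by (metis order_gt_0_iff_finite prime_gt_0_nat zero_less_power)
  obtain x y where xy: "x \<in> carrier G" "y \<in> carrier G" "x \<otimes> y \<noteq> y \<otimes> x"
    using nonabelian derived_subsetI[OF triv_subgroup, of "carrier G"] commutator_eq_one_iff
    by (metis singleton_iff)
  define Cen where "Cen S = {g \<in> carrier G. \<forall>s\<in>S. g \<otimes> s = s \<otimes> g}" for S
  have Cen: "subgroup (Cen S) G" if "S \<subseteq> carrier G" for S
  proof -
    have "Cen S = centralizer_mod G {\<one>} S"
      using that commutator_eq_one_iff unfolding Cen_def centralizer_mod_def by auto
    then show ?thesis using subgroup_centralizer_mod[OF one_is_normal that] by simp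
  qed
  define C where "C = Cen {x}"
  have C: "subgroup C G" unfolding C_def by (rule Cen) (use xy in simp)
  interpret C: subgroup C G by (rule C)
  have C_iff: "g \<in> C \<longleftrightarrow> g \<in> carrier G \<and> g \<otimes> x = x \<otimes> g" for g
    unfolding C_def Cen_def by blast
  have ZC: "center G \<subseteq> C"
  proof
    fix z assume "z \<in> center G"
    then have "z \<in> carrier G" "x \<otimes> z = z \<otimes> x" using xy(1) unfolding center_def by blast+
    then show "z \<in> C" using C_iff by simp
  qed
  have "y \<notin> C" using xy(3) C_iff by metis
  have "x \<in> C" using xy(1) C_iff by simp
  have C_less: "C \<subset> carrier G" using \<open>y \<notin> C\<close> xy C.subset by blast
  have finC: "finite C" using fin C.subset finite_subset by blast
  \<comment> \<open>elements with the same commutator with \<open>x\<close> lie in the same left coset of \<open>C\<close>\<close>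
  have index: "card (rcosets C) = p"
  proof -
    let ?f = "\<lambda>g. g \<otimes> x \<otimes> inv g \<otimes> inv x"
    have "card (carrier G) \<le> card (?f ` carrier G) * card C"
    proof (rule card_le_fibres[OF fin])
      fix g assume g: "g \<in> carrier G"
      have "{h \<in> carrier G. ?f h = ?f g} \<subseteq> (\<lambda>c. g \<otimes> c) ` C"
      proof (intro subsetI)
        fix h assume "h \<in> {h \<in> carrier G. ?f h = ?f g}"
        then have h: "h \<in> carrier G" "?f h = ?f g" by auto
        then have eq: "h \<otimes> x \<otimes> inv h = g \<otimes> x \<otimes> inv g" using g xy(1) by simp
        have "(inv g \<otimes> h) \<otimes> x = inv g \<otimes> (h \<otimes> x \<otimes> inv h) \<otimes> h"
          using g h xy(1) by (simp add: m_assoc)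
        also have "\<dots> = x \<otimes> (inv g \<otimes> h)"
          unfolding eq using g h xy(1) by (simp add: m_assoc mult_inv_cancel)
        finally have "inv g \<otimes> h \<in> C" using g h C_iff by simp
        moreover have "h = g \<otimes> (inv g \<otimes> h)" using g h by (simp add: mult_inv_cancel)
        ultimately show "h \<in> (\<lambda>c. g \<otimes> c) ` C" by (rule rev_image_eqI)
      qed
      then show "card {h \<in> carrier G. ?f h = ?f g} \<le> card C"
        using surj_card_le[OF finC] by blast
    qed
    also have "card (?f ` carrier G) \<le> card P"
    proof (rule card_mono)
      show "finite P" using fin subgroup.subset[OF P(1)] finite_subset by blast
      show "?f ` carrier G \<subseteq> P" using P(4) commutator_in_derived xy(1) by blast
    qed
    finally have "card (carrier G) \<le> p * card C" using P(2) by simp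
    moreover have "p * card C \<le> card (carrier G)"
      by (rule prime_mult_card_le_card[OF p ord C subgroup_self C_less])
    moreover have "card (rcosets C) * card C = card (carrier G)"
      using lagrange[OF C] by (simp add: Coset.order_def)
    moreover have "0 < card C" using finC C.one_closed card_gt_0_iff by blast
    ultimately show ?thesis by (metis le_antisym mult_right_cancel not_gr_zero)
  qed
  have "C \<lhd> G"
    unfolding normal_inv_iff
  proof (intro conjI ballI)
    fix g c assume g: "g \<in> carrier G" and c: "c \<in> C"
    have "g \<otimes> c \<otimes> inv g \<otimes> inv c \<in> C"
      using P(3,4) ZC commutator_in_derived[OF g C.mem_carrier[OF c]] by blast
    then have "g \<otimes> c \<otimes> inv g \<otimes> inv c \<otimes> c \<in> C" using c by (rule C.m_closed)
    then show "g \<otimes> c \<otimes> inv g \<in> C" using g c by (simp add: m_assoc)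
  qed (rule C)
  moreover have "a \<otimes> b = b \<otimes> a" if ab: "a \<in> C" "b \<in> C" for a b
  proof (rule ccontr)
    assume neq: "a \<otimes> b \<noteq> b \<otimes> a"
    define Z1 where "Z1 = C \<inter> Cen C"
    define C2 where "C2 = C \<inter> Cen {a}"
    have Z1: "subgroup Z1 G" unfolding Z1_def by (intro subgroups_Inter_pair C Cen C.subset)
    have C2: "subgroup C2 G"
      unfolding C2_def by (intro subgroups_Inter_pair C Cen) (use ab in auto)
    have "x \<otimes> c = c \<otimes> x" if "c \<in> C" for c using that C_iff by simp
    then have "x \<in> Z1" using \<open>x \<in> C\<close> xy(1) unfolding Z1_def Cen_def by blast
    moreover have "x \<notin> center G" using xy(2,3) unfolding center_def by force
    moreover have "center G \<subseteq> Z1"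
      using ZC C.subset unfolding Z1_def Cen_def center_def by force
    ultimately have less1: "center G \<subset> Z1" by blast
    have "Z1 \<subseteq> C2" using ab unfolding Z1_def C2_def Cen_def by blast
    moreover have "a \<in> C2" using ab(1) by (simp add: C2_def Cen_def)
    moreover have "a \<notin> Z1" using ab neq unfolding Z1_def Cen_def by blast
    ultimately have less2: "Z1 \<subset> C2" by blast
    have "b \<notin> C2" using neq unfolding C2_def Cen_def by force
    then have less3: "C2 \<subset> C" using ab unfolding C2_def by blast
    have "p * card (center G) \<le> card Z1"
      by (rule prime_mult_card_le_card[OF p ord subgroup_center Z1 less1])
    moreover have "p * card Z1 \<le> card C2"
      by (rule prime_mult_card_le_card[OF p ord Z1 C2 less2])
    moreover have "p * card C2 \<le> card C"
      by (rule prime_mult_card_le_card[OF p ord C2 C less3])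
    moreover have "p * card C \<le> card (carrier G)"
      by (rule prime_mult_card_le_card[OF p ord C subgroup_self C_less])
    ultimately have "p * (p * (p * (p * card (center G)))) \<le> card (carrier G)"
      by (meson le_trans mult_le_mono2)
    moreover have "p \<le> card (center G)"
      using card_mono[OF _ P(3)] P(2) fin subgroup.subset[OF subgroup_center] finite_subset by metis
    ultimately have "p * (p * (p * (p * p))) \<le> card (carrier G)"
      by (meson le_trans mult_le_mono2)
    moreover have "p * (p * (p * (p * p))) = p ^ 5" by (simp add: eval_nat_numeral)
    ultimately have "p ^ 5 \<le> p ^ 4"
      using small unfolding Coset.order_def by linarith
    then show False
      using power_strict_increasing[of 4 5 p] prime_gt_1_nat[OF p] by simp
  qed
  ultimately show ?thesis
    by (intro nonabelian_has_irr_character_of_prime_degree[OF fin p _ index _ nonabelian])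
qed

text \<open>Take \<open>N\<close> largest among the normal subgroups with nonabelian quotient.  A central subgroup of order \<open>p\<close>
in \<open>G/N\<close> has abelian quotient and so contains the derived subgroup of \<open>G/N\<close>.  The index of
the derived subgroup does not grow in quotients, so \<open>|G/N| \<le> p^3 p\<close>.\<close>

lemma (in group) has_irr_character_of_small_abelianization:
  assumes p: "Factorial_Ring.prime p" and ord: "Coset.order G = p ^ k"
    and nonabelian: "\<not> derived G (carrier G) \<subseteq> {\<one>}"
    and small: "Coset.order G \<le> p ^ 3 * card (derived G (carrier G))"
  shows "has_irr_character_of_degree G p"
proof -
  have fin: "finite (carrier G)"
    using ord p by (metis order_gt_0_iff_finite prime_gt_0_nat zero_less_power)
  define \<N> where "\<N> = {N. N \<lhd> G \<and> \<not> derived G (carrier G) \<subseteq> N}"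
  have "finite \<N>"
    by (rule finite_subset[of _ "Pow (carrier G)"])
       (auto simp: \<N>_def fin dest!: normal_imp_subgroup dest: subgroup.subset)
  moreover have "{\<one>} \<in> \<N>" unfolding \<N>_def using nonabelian one_is_normal by blast
  ultimately obtain N where N: "N \<in> \<N>" and max: "\<And>K. K \<in> \<N> \<Longrightarrow> N \<subseteq> K \<Longrightarrow> K = N"
    using finite_has_maximal[of \<N>] by auto
  interpret N: normal N G using N by (simp add: \<N>_def)
  let ?Q = "G Mod N"
  let ?\<pi> = "\<lambda>x. N #> x"
  interpret \<pi>: group_hom G ?Q ?\<pi> by (rule N.group_hom_r_coset)
  have surj: "?\<pi> ` carrier G = carrier ?Q" by (simp add: carrier_FactGroup)
  have derQ: "derived ?Q (carrier ?Q) = ?\<pi> ` derived G (carrier G)"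
    using \<pi>.derived_img[of "carrier G"] surj by simp
  have derG: "derived G (carrier G) \<subseteq> carrier G" by (rule derived_in_carrier) simp
  have nonabQ: "\<not> derived ?Q (carrier ?Q) \<subseteq> {\<one>\<^bsub>?Q\<^esub>}"
    unfolding derQ using N derG N.r_coset_eq_self_iff by (auto simp: \<N>_def)
  have lagN: "Coset.order ?Q * card N = Coset.order G"
    using lagrange[OF N.subgroup_axioms] by (simp add: Coset.order_def FactGroup_def)
  then have "Coset.order ?Q dvd p ^ k" using ord by (metis dvd_triv_left)
  then obtain j where j: "Coset.order ?Q = p ^ j" using divides_primepow_nat[OF p] by blast
  have "j \<noteq> 0"
  proof
    assume "j = 0"
    then have "carrier ?Q = {\<one>\<^bsub>?Q\<^esub>}" using j \<pi>.H.order_one_triv_iff by simp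
    then show False using nonabQ \<pi>.H.derived_in_carrier[of "carrier ?Q"] by simp
  qed
  define Z where "Z = center ?Q"
  have Z: "subgroup Z ?Q" unfolding Z_def by (rule \<pi>.H.subgroup_center)
  have finQ: "finite (carrier ?Q)" using fin surj by (metis finite_imageI)
  have finZ: "finite Z" using subgroup.subset[OF Z] finQ finite_subset by blast
  have "card Z dvd p ^ j" using \<pi>.H.lagrange[OF Z] j by (metis dvd_triv_right)
  then obtain i where i: "card Z = p ^ i" using divides_primepow_nat[OF p] by blast
  have "Z \<noteq> {\<one>\<^bsub>?Q\<^esub>}"
    unfolding Z_def using \<open>j \<noteq> 0\<close> by (intro \<pi>.H.center_nontrivial[OF p j]) simp
  then have "i \<noteq> 0"
    using i subgroup.one_closed[OF Z] by (auto simp: card_1_singleton_iff)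
  then obtain l where "i = Suc l" by (cases i) auto
  then have "Coset.order (?Q\<lparr>carrier := Z\<rparr>) = p ^ 1 * p ^ l" using i by (simp add: Coset.order_def)
  from sylow_thm[OF p \<pi>.H.subgroup_imp_group[OF Z] this] finZ
  obtain P where P: "subgroup P (?Q\<lparr>carrier := Z\<rparr>)" "card P = p" by auto
  have PZ: "P \<subseteq> Z" using subgroup.subset[OF P(1)] by simp
  have PQ: "subgroup P ?Q" using \<pi>.H.incl_subgroup[OF Z P(1)] .
  define K where "K = {x \<in> carrier G. ?\<pi> x \<in> P}"
  have K: "subgroup K G" unfolding K_def by (rule \<pi>.subgroup_preimage[OF PQ])
  have "K \<lhd> G"
    unfolding normal_inv_iff
  proof (intro conjI ballI)
    fix g h assume g: "g \<in> carrier G" and h: "h \<in> K"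
    have hG: "h \<in> carrier G" "?\<pi> h \<in> P" using h by (auto simp: K_def)
    then have "?\<pi> g \<otimes>\<^bsub>?Q\<^esub> ?\<pi> h = ?\<pi> h \<otimes>\<^bsub>?Q\<^esub> ?\<pi> g"
      using PZ g \<pi>.hom_closed[OF g] unfolding Z_def center_def by blast
    then have "?\<pi> (g \<otimes> h \<otimes> inv g) = ?\<pi> h \<otimes>\<^bsub>?Q\<^esub> ?\<pi> g \<otimes>\<^bsub>?Q\<^esub> inv\<^bsub>?Q\<^esub> ?\<pi> g"
      using g hG(1) by (simp only: \<pi>.hom_mult \<pi>.hom_inv inv_closed m_closed)
    also have "\<dots> = ?\<pi> h"
      using \<pi>.hom_closed[OF g] \<pi>.hom_closed[OF hG(1)]
      by (simp only: \<pi>.H.m_assoc \<pi>.H.inv_closed \<pi>.H.r_inv \<pi>.H.r_one)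
    finally have "?\<pi> (g \<otimes> h \<otimes> inv g) = ?\<pi> h" .
    then show "g \<otimes> h \<otimes> inv g \<in> K" using g hG by (simp add: K_def)
  qed (rule K)
  have "N \<subseteq> K"
  proof
    fix x assume x: "x \<in> N"
    have "N \<in> P" using subgroup.one_closed[OF PQ] by simp
    moreover have "?\<pi> x = N" using N.r_coset_eq_self_iff x by simp
    ultimately have "?\<pi> x \<in> P" by (simp only:)
    then show "x \<in> K" using x N.mem_carrier unfolding K_def by blast
  qed
  have "K \<noteq> N"
  proof
    assume "K = N"
    have "P \<subseteq> {N}"
    proof
      fix C assume C: "C \<in> P"
      then obtain x where x: "x \<in> carrier G" "C = ?\<pi> x"
        using subgroup.subset[OF PQ] surj by blast
      then have "x \<in> N" using C \<open>K = N\<close> by (auto simp: K_def)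
      then show "C \<in> {N}" using x N.r_coset_eq_self_iff by simp
    qed
    then have "card P \<le> 1" using card_mono[of "{N}" P] by simp
    then show False using P(2) prime_gt_1_nat[OF p] by simp
  qed
  then have "derived G (carrier G) \<subseteq> K"
    using max[of K] \<open>K \<lhd> G\<close> \<open>N \<subseteq> K\<close> by (auto simp: \<N>_def)
  then have derP: "derived ?Q (carrier ?Q) \<subseteq> P" unfolding derQ by (auto simp: K_def)
  have "Coset.order ?Q * card N \<le> p ^ 3 * card (derived G (carrier G))"
    using small lagN by simp
  also have "\<dots> \<le> p ^ 3 * (card (derived ?Q (carrier ?Q)) * card N)"
    unfolding derQ by (rule mult_le_mono2[OF N.card_le_card_image_r_coset[OF fin derG]])
  finally have "Coset.order ?Q * card N \<le> p ^ 3 * (card (derived ?Q (carrier ?Q)) * card N)" .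
  moreover have "0 < card N"
    using finite_subset[OF N.subset fin] N.one_closed card_gt_0_iff by blast
  ultimately have "Coset.order ?Q \<le> p ^ 3 * card (derived ?Q (carrier ?Q))"
    by (simp add: mult.assoc[symmetric])
  also have "card (derived ?Q (carrier ?Q)) \<le> card P"
    using derP finite_subset[OF PZ finZ] by (intro card_mono)
  also have "p ^ 3 * card P = p ^ 4" using P(2) by (simp add: eval_nat_numeral)
  finally have "Coset.order ?Q \<le> p ^ 4" by simp
  then have "has_irr_character_of_degree ?Q p"
    using P(2) PZ derP nonabQ unfolding Z_def
    by (intro \<pi>.H.has_irr_character_of_central_derived[OF p j PQ]) simp_all
  then show ?thesis
    by (rule has_irr_character_of_degree_inflate[OF \<pi>.group_hom_axioms surj])
qed

section \<open>Exceptional maximal subgroups\<close>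

text \<open>On the abelian normal subgroup \<open>A\<close> the map \<open>a \<mapsto> [a, y]\<close> is an endomorphism.  Its image is a subgroup which
is centralized by \<open>A\<close> and normalized by \<open>y\<close>, hence normal, and modulo the image \<open>y\<close> commutes with \<open>A\<close>.\<close>

lemma (in group) derived_subset_commutators:
  assumes A: "maximal_subgroup A G" "A \<lhd> G"
    and comm: "\<And>a b. a \<in> A \<Longrightarrow> b \<in> A \<Longrightarrow> a \<otimes> b = b \<otimes> a"
    and y: "y \<in> carrier G" "y \<notin> A"
  shows "derived G (carrier G) \<subseteq> (\<lambda>a. a \<otimes> y \<otimes> inv a \<otimes> inv y) ` A"
proof -
  interpret A: normal A G by (rule A(2))
  let ?c = "\<lambda>a. a \<otimes> y \<otimes> inv a \<otimes> inv y"
  have cA: "?c a \<in> A" if "a \<in> A" for a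
  proof -
    have "a \<otimes> (y \<otimes> inv a \<otimes> inv y) \<in> A" using that y A.inv_op_closed2 by blast
    then show ?thesis using that y by (simp add: m_assoc)
  qed
  have c_mult: "?c (a \<otimes> b) = ?c a \<otimes> ?c b" if ab: "a \<in> A" "b \<in> A" for a b
  proof -
    have conj: "y \<otimes> inv a \<otimes> inv y \<in> A" using ab y A.inv_op_closed2 by blast
    have "?c (a \<otimes> b) = a \<otimes> (b \<otimes> y \<otimes> inv b \<otimes> inv y) \<otimes> (y \<otimes> inv a \<otimes> inv y)"
      using ab y by (simp add: inv_mult_group m_assoc) (simp add: m_assoc[symmetric])
    also have "\<dots> = a \<otimes> ((y \<otimes> inv a \<otimes> inv y) \<otimes> ?c b)"
      using comm[OF cA[OF ab(2)] conj] ab y by (simp add: m_assoc)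
    also have "\<dots> = ?c a \<otimes> ?c b" using ab y by (simp add: m_assoc)
    finally show ?thesis .
  qed
  have sub: "subgroup (?c ` A) G"
  proof (rule subgroupI)
    show "?c ` A \<subseteq> carrier G" using cA A.subset by blast
    show "?c ` A \<noteq> {}" using A.one_closed by blast
    fix u assume "u \<in> ?c ` A"
    then obtain a where a: "a \<in> A" "u = ?c a" by blast
    have "?c (inv a) \<otimes> ?c a = \<one>" using c_mult[of "inv a" a] a y by simp
    then have "inv u = ?c (inv a)" using a y by (intro inv_equality) auto
    then show "inv u \<in> ?c ` A" using a by blast
    fix v assume "v \<in> ?c ` A"
    then obtain b where b: "b \<in> A" "v = ?c b" by blast
    have "u \<otimes> v = ?c (a \<otimes> b)" using c_mult a b by simp
    then show "u \<otimes> v \<in> ?c ` A" using a b by blast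
  qed
  have A_trivial: "a \<otimes> ?c b \<otimes> inv a = ?c b" if "a \<in> A" "b \<in> A" for a b
    using comm[OF that(1) cA[OF that(2)]] that y by (simp add: m_assoc)
  have normal: "?c ` A \<lhd> G"
  proof -
    \<comment> \<open>the normalizer of the image, with both directions of conjugation built in so that it is closed under inverses\<close>
    define L where
      "L = {g \<in> carrier G. \<forall>u\<in>?c ` A. g \<otimes> u \<otimes> inv g \<in> ?c ` A \<and> inv g \<otimes> u \<otimes> g \<in> ?c ` A}"
    have memL: "g \<in> L" if "g \<in> carrier G"
      "\<And>a. a \<in> A \<Longrightarrow> g \<otimes> ?c a \<otimes> inv g \<in> ?c ` A" "\<And>a. a \<in> A \<Longrightarrow> inv g \<otimes> ?c a \<otimes> g \<in> ?c ` A" for g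
      unfolding L_def using that by blast
    have L1: "g \<otimes> ?c a \<otimes> inv g \<in> ?c ` A" "inv g \<otimes> ?c a \<otimes> g \<in> ?c ` A"
      if "g \<in> L" "a \<in> A" for g a
      using that unfolding L_def by blast+
    have L_carrier: "g \<in> carrier G" if "g \<in> L" for g using that unfolding L_def by blast
    have L: "subgroup L G"
    proof (rule subgroupI)
      show "L \<subseteq> carrier G" unfolding L_def by blast
      have "\<one> \<in> L" by (rule memL) (use y in auto)
      then show "L \<noteq> {}" by blast
      fix g assume g: "g \<in> L"
      show "inv g \<in> L"
        by (rule memL) (use L1[OF g] L_carrier[OF g] in auto)
      fix h assume h: "h \<in> L"
      show "g \<otimes> h \<in> L"
      proof (rule memL)
        fix a assume a: "a \<in> A"
        obtain b where b: "b \<in> A" "h \<otimes> ?c a \<otimes> inv h = ?c b" using L1(1)[OF h a] by blast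
        have "g \<otimes> h \<otimes> ?c a \<otimes> inv (g \<otimes> h) = g \<otimes> (h \<otimes> ?c a \<otimes> inv h) \<otimes> inv g"
          using L_carrier[OF g] L_carrier[OF h] a y by (simp add: m_assoc inv_mult_group)
        then show "g \<otimes> h \<otimes> ?c a \<otimes> inv (g \<otimes> h) \<in> ?c ` A"
          unfolding b(2) using L1(1)[OF g b(1)] by simp
        obtain d where d: "d \<in> A" "inv g \<otimes> ?c a \<otimes> g = ?c d" using L1(2)[OF g a] by blast
        have "inv (g \<otimes> h) \<otimes> ?c a \<otimes> (g \<otimes> h) = inv h \<otimes> (inv g \<otimes> ?c a \<otimes> g) \<otimes> h"
          using L_carrier[OF g] L_carrier[OF h] a y by (simp add: m_assoc inv_mult_group)
        then show "inv (g \<otimes> h) \<otimes> ?c a \<otimes> (g \<otimes> h) \<in> ?c ` A"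
          unfolding d(2) using L1(2)[OF h d(1)] by simp
      qed (use L_carrier[OF g] L_carrier[OF h] in simp)
    qed
    have "a \<in> L" if a: "a \<in> A" for a
    proof (rule memL)
      fix b assume b: "b \<in> A"
      show "a \<otimes> ?c b \<otimes> inv a \<in> ?c ` A" using A_trivial[OF a b] b by simp
      have "inv a \<otimes> ?c b \<otimes> inv (inv a) \<in> ?c ` A"
        using A_trivial[OF A.m_inv_closed[OF a] b] b by simp
      then show "inv a \<otimes> ?c b \<otimes> a \<in> ?c ` A" using a by simp
    qed (use a in simp)
    then have "A \<subseteq> L" by blast
    moreover have "y \<in> L"
    proof (rule memL)
      fix a assume a: "a \<in> A"
      have "y \<otimes> ?c a \<otimes> inv y = ?c (y \<otimes> a \<otimes> inv y)"
        using a y by (simp add: m_assoc inv_mult_group mult_inv_cancel)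
      moreover have "y \<otimes> a \<otimes> inv y \<in> A" using a y A.inv_op_closed2 by blast
      ultimately show "y \<otimes> ?c a \<otimes> inv y \<in> ?c ` A" by simp
      have "inv y \<otimes> ?c a \<otimes> y = ?c (inv y \<otimes> a \<otimes> y)"
        using a y by (simp add: m_assoc inv_mult_group mult_inv_cancel)
      moreover have "inv y \<otimes> a \<otimes> y \<in> A" using a y A.inv_op_closed1 by blast
      ultimately show "inv y \<otimes> ?c a \<otimes> y \<in> ?c ` A" by simp
    qed (use y in simp)
    ultimately have "L = carrier G"
      using A(1) L y unfolding maximal_subgroup_def by blast
    then show ?thesis
      unfolding normal_inv_iff using sub L1(1) by blast
  qed
  show ?thesis
  proof (rule derived_subset_of_maximal_subgroup[OF normal A(1) _ y])
    fix a b assume ab: "a \<in> A" "b \<in> A"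
    have "a \<otimes> b \<otimes> inv a \<otimes> inv b = \<one>"
      by (rule commutator_eq_one[OF A.mem_carrier[OF ab(1)] A.mem_carrier[OF ab(2)] comm[OF ab]])
    then show "a \<otimes> b \<otimes> inv a \<otimes> inv b \<in> ?c ` A" using subgroup.one_closed[OF sub] by simp
  qed blast
qed

lemma (in group) derived_subset_maximal_subgroup:
  assumes p: "Factorial_Ring.prime (p::nat)" and ord: "Coset.order G = p ^ k"
    and M: "maximal_subgroup M G"
  shows "derived G (carrier G) \<subseteq> M"
proof -
  interpret M: normal M G by (rule maximal_subgroup_normal[OF assms])
  obtain y where y: "y \<in> carrier G" "y \<notin> M"
    using M M.subset unfolding maximal_subgroup_def by blast
  show ?thesis
  proof (rule derived_subset_of_maximal_subgroup[OF M.normal_axioms M _ y])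
    fix a assume a: "a \<in> M"
    have "a \<otimes> (y \<otimes> inv a \<otimes> inv y) \<in> M" using a y M.inv_op_closed2 by blast
    then show "a \<otimes> y \<otimes> inv a \<otimes> inv y \<in> M" using a y by (simp add: m_assoc)
  qed simp
qed

text \<open>Otherwise \<open>H/M'\<close> is nonabelian with the abelian normal subgroup \<open>(H \<inter> M)/M'\<close> of index \<open>p\<close>, and a
character of degree \<open>p\<close> of \<open>H/M'\<close> inflates to \<open>H\<close>.\<close>

lemma (in group) exceptional_maximal_subgroup_derived:
  assumes p: "Factorial_Ring.prime p" and ord: "Coset.order G = p ^ k"
    and H: "maximal_subgroup H G" and M: "maximal_subgroup M G" and "M \<noteq> H"
    and exceptional: "\<not> has_irr_character_of_degree (G\<lparr>carrier := H\<rparr>) p"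
  shows "derived G H \<subseteq> derived G M"
proof (rule ccontr)
  assume not_sub: "\<not> derived G H \<subseteq> derived G M"
  have fin: "finite (carrier G)"
    using ord p by (metis order_gt_0_iff_finite prime_gt_0_nat zero_less_power)
  define N where "N = derived G M"
  have M_normal: "M \<lhd> G" and H_normal: "H \<lhd> G"
    using maximal_subgroup_normal[OF p ord] M H by auto
  interpret M: normal M G by (rule M_normal)
  interpret H: normal H G by (rule H_normal)
  have N_normal: "N \<lhd> G" unfolding N_def by (rule derived_is_normal[OF M_normal])
  interpret N: normal N G by (rule N_normal)
  have "N \<subseteq> M" unfolding N_def by (rule derived_incl[OF _ M.subgroup_axioms]) simp
  have "N \<subseteq> derived G (carrier G)" unfolding N_def by (rule mono_derived[OF M.subset])
  then have "N \<subseteq> H" using derived_subset_maximal_subgroup[OF p ord H] by blast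
  let ?GH = "G\<lparr>carrier := H\<rparr>"
  interpret GH: group ?GH by (rule subgroup_imp_group[OF H.subgroup_axioms])
  interpret NH: normal N ?GH
    by (rule normal_restrict_supergroup[OF H.subgroup_axioms N_normal \<open>N \<subseteq> H\<close>])
  let ?X = "?GH Mod N"
  let ?\<pi> = "\<lambda>x. N #>\<^bsub>?GH\<^esub> x"
  interpret \<pi>: group_hom ?GH ?X ?\<pi> by (rule NH.group_hom_r_coset)
  have surj: "?\<pi> ` H = carrier ?X" by (auto simp: carrier_FactGroup)
  define A where "A = ?\<pi> ` (H \<inter> M)"
  have HM_sub: "subgroup (H \<inter> M) G"
    by (rule subgroups_Inter_pair[OF H.subgroup_axioms M.subgroup_axioms])
  have HM_normal: "H \<inter> M \<lhd> ?GH"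
    using normal_Int_subgroup[OF H.subgroup_axioms M_normal] by (simp add: Int_commute)
  have finH: "finite H" using fin H.subset finite_subset by blast
  have "A \<lhd> ?X"
    unfolding A_def
    using normal.surj_hom_normal_subgroup[OF HM_normal \<pi>.group_hom_axioms] surj by simp
  moreover have "card (rcosets\<^bsub>?X\<^esub> A) = p"
  proof -
    have "H \<noteq> carrier G" "M \<noteq> carrier G" using H M by (auto simp: maximal_subgroup_def)
    then have "\<not> H \<subseteq> M"
      using H M.subgroup_axioms \<open>M \<noteq> H\<close> unfolding maximal_subgroup_def by blast
    then have "H \<inter> M \<subset> H" by blast
    then have "p * card (H \<inter> M) \<le> card H"
      by (rule prime_mult_card_le_card[OF p ord HM_sub H.subgroup_axioms])
    moreover have "card H \<le> p * card (H \<inter> M)"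
      using card_subgroup_le_index_mult[OF fin H.subgroup_axioms M.subgroup_axioms]
        maximal_subgroup_index[OF p ord M] by simp
    ultimately have "card H = p * card (H \<inter> M)" by simp
    moreover have "card A * card N = card (H \<inter> M)"
      unfolding A_def using \<open>N \<subseteq> H\<close> \<open>N \<subseteq> M\<close>
      by (simp add: card_image_r_coset[OF N_normal HM_sub])
    moreover have "Coset.order ?X * card N = card H"
      using card_image_r_coset[OF N_normal H.subgroup_axioms \<open>N \<subseteq> H\<close>] surj
      by (simp add: Coset.order_def)
    moreover have "card (rcosets\<^bsub>?X\<^esub> A) * card A = Coset.order ?X"
      by (rule \<pi>.H.lagrange[OF normal_imp_subgroup[OF \<open>A \<lhd> ?X\<close>]])
    moreover have "0 < card (H \<inter> M)"
      using finH H.one_closed M.one_closed card_gt_0_iff[of "H \<inter> M"] by blast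
    ultimately have "card (rcosets\<^bsub>?X\<^esub> A) * card (H \<inter> M) = p * card (H \<inter> M)"
      by (metis mult.assoc)
    then show ?thesis using \<open>0 < card (H \<inter> M)\<close> by simp
  qed
  moreover have "u \<otimes>\<^bsub>?X\<^esub> v = v \<otimes>\<^bsub>?X\<^esub> u" if "u \<in> A" "v \<in> A" for u v
  proof -
    from that(1) obtain a where a: "a \<in> H \<inter> M" "u = ?\<pi> a" unfolding A_def by (rule imageE)
    from that(2) obtain b where b: "b \<in> H \<inter> M" "v = ?\<pi> b" unfolding A_def by (rule imageE)
    have "a \<otimes> b \<otimes> inv a \<otimes> inv b \<in> N"
      unfolding N_def using a b by (intro commutator_in_derived) simp_all
    moreover have "inv\<^bsub>?GH\<^esub> a = inv a" "inv\<^bsub>?GH\<^esub> b = inv b"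
      using a b by (simp_all add: m_inv_consistent[OF H.subgroup_axioms])
    ultimately have "a \<otimes>\<^bsub>?GH\<^esub> b \<otimes>\<^bsub>?GH\<^esub> inv\<^bsub>?GH\<^esub> a \<otimes>\<^bsub>?GH\<^esub> inv\<^bsub>?GH\<^esub> b \<in> N" by simp
    then have "?\<pi> (a \<otimes>\<^bsub>?GH\<^esub> b \<otimes>\<^bsub>?GH\<^esub> inv\<^bsub>?GH\<^esub> a \<otimes>\<^bsub>?GH\<^esub> inv\<^bsub>?GH\<^esub> b) = N"
      using NH.r_coset_eq_self_iff NH.mem_carrier by blast
    then have "?\<pi> (a \<otimes>\<^bsub>?GH\<^esub> b \<otimes>\<^bsub>?GH\<^esub> inv\<^bsub>?GH\<^esub> a \<otimes>\<^bsub>?GH\<^esub> inv\<^bsub>?GH\<^esub> b) = \<one>\<^bsub>?X\<^esub>"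
      by (simp only: one_FactGroup)
    then show ?thesis
      unfolding a(2) b(2) using a(1) b(1) by (intro \<pi>.image_commute) simp_all
  qed
  moreover have "\<not> derived ?X (carrier ?X) \<subseteq> {\<one>\<^bsub>?X\<^esub>}"
  proof
    assume trivial: "derived ?X (carrier ?X) \<subseteq> {\<one>\<^bsub>?X\<^esub>}"
    have "derived ?X (?\<pi> ` H) = ?\<pi> ` derived ?GH H"
      by (rule \<pi>.derived_img) simp
    then have der: "derived ?X (carrier ?X) = ?\<pi> ` derived G H"
      unfolding surj derived_consistent[OF subset_refl H.subgroup_axioms] .
    have derH: "derived G H \<subseteq> H" by (rule derived_incl[OF subset_refl H.subgroup_axioms])
    obtain x where x: "x \<in> derived G H" "x \<notin> N" using not_sub N_def by blast
    then have "?\<pi> x \<in> {\<one>\<^bsub>?X\<^esub>}" using trivial der by blast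
    then have "?\<pi> x = N" by (simp only: singleton_iff one_FactGroup)
    moreover have "x \<in> carrier ?GH" using x derH by auto
    ultimately show False using NH.r_coset_eq_self_iff x(2) by blast
  qed
  moreover have "finite (carrier ?X)" using finH surj by (metis finite_imageI)
  ultimately have "has_irr_character_of_degree ?X p"
    using \<pi>.H.nonabelian_has_irr_character_of_prime_degree[OF _ p, of A] by blast
  then have "has_irr_character_of_degree ?GH p"
    using has_irr_character_of_degree_inflate[OF \<pi>.group_hom_axioms] surj by simp
  then show False using exceptional by blast
qed

text \<open>In \<open>Q = G/M'\<close> the images of \<open>H\<close> and \<open>M\<close> are abelian.  Every element of \<open>Q'\<close> is a commutator of an element
of \<open>M/M'\<close> with a fixed \<open>y \<in> H - M\<close>; multiplying the former by an element of \<open>H\<close> does not change the commutator, so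
there are at most \<open>|G:H| = p\<close> of them.\<close>

lemma (in group) card_derived_le_of_maximal_subgroups:
  assumes p: "Factorial_Ring.prime p" and ord: "Coset.order G = p ^ k"
    and H: "maximal_subgroup H G" and M: "maximal_subgroup M G" and "M \<noteq> H"
    and sub: "derived G H \<subseteq> derived G M"
  shows "card (derived G (carrier G)) \<le> p * card (derived G M)"
proof -
  have fin: "finite (carrier G)"
    using ord p by (metis order_gt_0_iff_finite prime_gt_0_nat zero_less_power)
  define N where "N = derived G M"
  have M_normal: "M \<lhd> G" and H_normal: "H \<lhd> G"
    using maximal_subgroup_normal[OF p ord] M H by auto
  interpret M: normal M G by (rule M_normal)
  interpret H: normal H G by (rule H_normal)
  have N_normal: "N \<lhd> G" unfolding N_def by (rule derived_is_normal[OF M_normal])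
  interpret N: normal N G by (rule N_normal)
  have "N \<subseteq> M" unfolding N_def by (rule derived_incl[OF _ M.subgroup_axioms]) simp
  let ?Q = "G Mod N"
  let ?\<pi> = "\<lambda>x. N #> x"
  interpret \<pi>: group_hom G ?Q ?\<pi> by (rule N.group_hom_r_coset)
  have surj: "?\<pi> ` carrier G = carrier ?Q" by (simp add: carrier_FactGroup)
  have ker: "kernel G ?Q ?\<pi> = N"
    using N.r_coset_eq_self_iff N.subset by (auto simp: kernel_def)
  have "H \<noteq> carrier G" "M \<noteq> carrier G" using H M by (auto simp: maximal_subgroup_def)
  then have "\<not> H \<subseteq> M"
    using H M.subgroup_axioms \<open>M \<noteq> H\<close> unfolding maximal_subgroup_def by blast
  then obtain y where y: "y \<in> H" "y \<notin> M" by blast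
  define A where "A = ?\<pi> ` M"
  have A: "maximal_subgroup A ?Q"
    unfolding A_def by (rule \<pi>.maximal_subgroup_image[OF surj _ M]) (simp add: ker \<open>N \<subseteq> M\<close>)
  have A_normal: "A \<lhd> ?Q"
    unfolding A_def
    by (rule normal.surj_hom_normal_subgroup[OF M_normal \<pi>.group_hom_axioms surj])
  have comm: "?\<pi> a \<otimes>\<^bsub>?Q\<^esub> ?\<pi> b = ?\<pi> b \<otimes>\<^bsub>?Q\<^esub> ?\<pi> a"
    if "a \<otimes> b \<otimes> inv a \<otimes> inv b \<in> N" "a \<in> carrier G" "b \<in> carrier G" for a b
  proof -
    have "?\<pi> (a \<otimes> b \<otimes> inv a \<otimes> inv b) = N"
      using that N.r_coset_eq_self_iff N.mem_carrier by blast
    then have "?\<pi> (a \<otimes> b \<otimes> inv a \<otimes> inv b) = \<one>\<^bsub>?Q\<^esub>" by (simp only: one_FactGroup)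
    then show ?thesis by (rule \<pi>.image_commute[OF that(2,3)])
  qed
  have A_comm: "u \<otimes>\<^bsub>?Q\<^esub> v = v \<otimes>\<^bsub>?Q\<^esub> u" if "u \<in> A" "v \<in> A" for u v
  proof -
    from that(1) obtain a where a: "u = ?\<pi> a" "a \<in> M" unfolding A_def by (rule imageE)
    from that(2) obtain b where b: "v = ?\<pi> b" "b \<in> M" unfolding A_def by (rule imageE)
    have "a \<otimes> b \<otimes> inv a \<otimes> inv b \<in> N"
      unfolding N_def by (rule commutator_in_derived[OF a(2) b(2)])
    then show ?thesis
      unfolding a(1) b(1) by (rule comm[OF _ M.mem_carrier[OF a(2)] M.mem_carrier[OF b(2)]])
  qed
  have yG: "y \<in> carrier G" using y by simp
  then have yQ: "?\<pi> y \<in> carrier ?Q" by (rule \<pi>.hom_closed)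
  have "?\<pi> y \<notin> A"
  proof
    assume "?\<pi> y \<in> A"
    then obtain m where m: "?\<pi> y = ?\<pi> m" "m \<in> M" unfolding A_def by (rule imageE)
    then have "y \<in> N #> m" using rcos_self[OF _ N.subgroup_axioms, of y] y by simp
    then have "y \<otimes> inv m \<in> M" using N.rcos_module_imp[OF is_group] m \<open>N \<subseteq> M\<close> by auto
    then have "y \<otimes> inv m \<otimes> m \<in> M" using m by blast
    then show False using y m by (simp add: m_assoc)
  qed
  let ?c = "\<lambda>a. a \<otimes>\<^bsub>?Q\<^esub> ?\<pi> y \<otimes>\<^bsub>?Q\<^esub> inv\<^bsub>?Q\<^esub> a \<otimes>\<^bsub>?Q\<^esub> inv\<^bsub>?Q\<^esub> ?\<pi> y"
  have der: "derived ?Q (carrier ?Q) \<subseteq> ?c ` A"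
    by (rule \<pi>.H.derived_subset_commutators[OF A A_normal A_comm yQ \<open>?\<pi> y \<notin> A\<close>])
  have const: "?c (?\<pi> m) = ?c (?\<pi> n)" if mn: "m \<in> M" "n \<in> M" "H #> m = H #> n" for m n
  proof -
    have "m \<in> H #> n" using rcos_self[OF _ H.subgroup_axioms, of m] mn by simp
    then have "m \<otimes> inv n \<in> H" using H.rcos_module_imp[OF is_group] mn by simp
    then have "inv n \<otimes> (m \<otimes> inv n) \<otimes> n \<in> H" using mn H.inv_op_closed1 by simp
    then have z: "inv n \<otimes> m \<in> H" using mn by (simp add: m_assoc)
    let ?z = "?\<pi> (inv n \<otimes> m)"
    have "inv n \<otimes> m \<otimes> y \<otimes> inv (inv n \<otimes> m) \<otimes> inv y \<in> derived G H"
      by (rule commutator_in_derived[OF z y(1)])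
    then have "inv n \<otimes> m \<otimes> y \<otimes> inv (inv n \<otimes> m) \<otimes> inv y \<in> N"
      using sub unfolding N_def by blast
    then have zy: "?z \<otimes>\<^bsub>?Q\<^esub> ?\<pi> y = ?\<pi> y \<otimes>\<^bsub>?Q\<^esub> ?z"
      by (rule comm[OF _ H.mem_carrier[OF z] yG])
    have nG: "n \<in> carrier G" using mn by simp
    have zQ: "?z \<in> carrier ?Q" "?\<pi> n \<in> carrier ?Q"
      by (rule \<pi>.hom_closed[OF H.mem_carrier[OF z]], rule \<pi>.hom_closed[OF nG])
    have "n \<otimes> (inv n \<otimes> m) = m" using mn by (simp add: mult_inv_cancel)
    then have m: "?\<pi> m = ?\<pi> n \<otimes>\<^bsub>?Q\<^esub> ?z"
      using \<pi>.hom_mult[OF nG H.mem_carrier[OF z]] by (simp only:)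
    have "?c (?\<pi> m) = ?\<pi> n \<otimes>\<^bsub>?Q\<^esub> (?z \<otimes>\<^bsub>?Q\<^esub> ?\<pi> y) \<otimes>\<^bsub>?Q\<^esub> inv\<^bsub>?Q\<^esub> ?z \<otimes>\<^bsub>?Q\<^esub> inv\<^bsub>?Q\<^esub> ?\<pi> n \<otimes>\<^bsub>?Q\<^esub> inv\<^bsub>?Q\<^esub> ?\<pi> y"
      unfolding m using zQ yQ
      by (simp only: \<pi>.H.m_assoc \<pi>.H.inv_mult_group \<pi>.H.m_closed \<pi>.H.inv_closed)
    also have "\<dots> = ?c (?\<pi> n)"
      unfolding zy using zQ yQ
      by (simp only: \<pi>.H.m_assoc \<pi>.H.mult_inv_cancel \<pi>.H.m_closed \<pi>.H.inv_closed)
    finally show ?thesis .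
  qed
  have finA: "finite (?c ` A)"
    unfolding A_def by (intro finite_imageI finite_subset[OF M.subset fin])
  have "card (?c ` A) \<le> p"
  proof -
    \<comment> \<open>the commutator is read off from an arbitrary representative in \<open>M\<close> of the coset of \<open>H\<close>\<close>
    have "?c ` A \<subseteq> (\<lambda>C. ?c (?\<pi> (SOME m. m \<in> M \<and> H #> m = C))) ` (rcosets H)"
    proof
      fix u assume "u \<in> ?c ` A"
      then obtain m where m: "m \<in> M" "u = ?c (?\<pi> m)" unfolding A_def by (elim imageE) simp
      have "(SOME n. n \<in> M \<and> H #> n = H #> m) \<in> M \<and> H #> (SOME n. n \<in> M \<and> H #> n = H #> m) = H #> m"
        by (rule someI[of _ m]) (use m in simp)
      then have "u = ?c (?\<pi> (SOME n. n \<in> M \<and> H #> n = H #> m))"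
        unfolding m(2) by (intro const[OF m(1)]) simp_all
      moreover have "H #> m \<in> rcosets H" using m by (intro rcosetsI) auto
      ultimately show "u \<in> (\<lambda>C. ?c (?\<pi> (SOME m. m \<in> M \<and> H #> m = C))) ` (rcosets H)"
        by (rule rev_image_eqI[rotated])
    qed
    moreover have "finite (rcosets H)" using fin by (simp add: RCOSETS_def)
    ultimately show ?thesis
      using surj_card_le[of "rcosets H"] maximal_subgroup_index[OF p ord H] by simp
  qed
  then have "card (derived ?Q (carrier ?Q)) \<le> p"
    using card_mono[OF finA der] by simp
  moreover have "derived ?Q (carrier ?Q) = ?\<pi> ` derived G (carrier G)"
    using \<pi>.derived_img[OF subset_refl] unfolding surj .
  moreover have "card (?\<pi> ` derived G (carrier G)) * card N = card (derived G (carrier G))"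
    by (rule card_image_r_coset[OF N_normal derived_is_subgroup])
       (simp_all add: N_def mono_derived M.subset)
  ultimately show ?thesis unfolding N_def[symmetric] by (metis mult_le_mono1)
qed

lemma (in group) index_derived_of_exceptional:
  assumes p: "Factorial_Ring.prime p" and ord: "Coset.order G = p ^ k"
    and H: "maximal_subgroup H G" and M: "maximal_subgroup M G" and "M \<noteq> H"
    and exceptional: "\<not> has_irr_character_of_degree (G\<lparr>carrier := H\<rparr>) p"
  shows "subgroup_index (G\<lparr>carrier := M\<rparr>) (commutator_subgroup (G\<lparr>carrier := M\<rparr>))
           \<le> subgroup_index G (commutator_subgroup G)"
proof -
  have sub_M: "subgroup M G" using M by (simp add: maximal_subgroup_def)
  interpret GM: group "G\<lparr>carrier := M\<rparr>" by (rule subgroup_imp_group[OF sub_M])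
  let ?D = "derived G (carrier G)" and ?E = "derived G M"
  have E: "commutator_subgroup (G\<lparr>carrier := M\<rparr>) = ?E"
    using derived_consistent[OF subset_refl sub_M] by simp
  define i where "i = subgroup_index (G\<lparr>carrier := M\<rparr>) ?E"
  define j where "j = subgroup_index G ?D"
  have "i * card ?E = card M"
    using GM.lagrange[OF GM.derived_is_subgroup[of M]] E
    by (simp add: i_def subgroup_index_def Coset.order_def)
  moreover have D: "subgroup ?D G" by (rule derived_is_subgroup) simp
  then have "j * card ?D = Coset.order G"
    using lagrange[OF D] by (simp add: j_def subgroup_index_def)
  moreover have "p * card M = Coset.order G"
    using lagrange[OF sub_M] maximal_subgroup_index[OF p ord M] by simp
  moreover have "card ?D \<le> p * card ?E"
    by (rule card_derived_le_of_maximal_subgroups[OF p ord H M \<open>M \<noteq> H\<close>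
          exceptional_maximal_subgroup_derived[OF p ord H M \<open>M \<noteq> H\<close> exceptional]])
  ultimately have "i * (p * card ?E) \<le> j * (p * card ?E)"
    by (metis mult.left_commute mult_le_mono2)
  moreover have "0 < p * card ?E"
  proof -
    have "0 < card M" using \<open>p * card M = Coset.order G\<close> ord p by (intro gr0I) auto
    then have "0 < card ?E" using \<open>i * card ?E = card M\<close> by (intro gr0I) auto
    then show ?thesis using prime_gt_0_nat[OF p] by simp
  qed
  ultimately have "i \<le> j" by simp
  then show ?thesis unfolding E i_def j_def .
qed

text \<open>Since \<open>|M| \<ge> p^4 > |M:M'|\<close>, the group \<open>M\<close> is nonabelian.\<close>

lemma (in group) maximal_subgroup_has_irr_character:
  assumes p: "Factorial_Ring.prime p" and ord: "Coset.order G = p ^ k"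
    and large: "p ^ 5 \<le> Coset.order G" and M: "maximal_subgroup M G"
    and small: "subgroup_index (G\<lparr>carrier := M\<rparr>) (commutator_subgroup (G\<lparr>carrier := M\<rparr>)) \<le> p ^ 3"
  shows "has_irr_character_of_degree (G\<lparr>carrier := M\<rparr>) p"
proof -
  have sub_M: "subgroup M G" using M by (simp add: maximal_subgroup_def)
  let ?GM = "G\<lparr>carrier := M\<rparr>"
  interpret GM: group ?GM by (rule subgroup_imp_group[OF sub_M])
  have lag: "p * card M = Coset.order G"
    using lagrange[OF sub_M] maximal_subgroup_index[OF p ord M] by simp
  then have "card M dvd p ^ k" using ord by (metis dvd_triv_right)
  then obtain i where i: "card M = p ^ i" using divides_primepow_nat[OF p] by blast
  have "p * p ^ 4 \<le> p * card M" using large lag by (simp add: eval_nat_numeral)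
  then have M_large: "p ^ 4 \<le> card M" using prime_gt_0_nat[OF p] by simp
  let ?D = "commutator_subgroup ?GM"
  have D: "subgroup ?D ?GM" by (rule GM.derived_is_subgroup) simp
  have "card M = subgroup_index ?GM ?D * card ?D"
    using GM.lagrange[OF D] unfolding subgroup_index_def Coset.order_def by simp
  then have "card M \<le> p ^ 3 * card ?D"
    using mult_le_mono1[OF small, of "card ?D"] by (simp only:)
  moreover have "\<not> ?D \<subseteq> {\<one>\<^bsub>?GM\<^esub>}"
  proof
    assume "?D \<subseteq> {\<one>\<^bsub>?GM\<^esub>}"
    then have "card ?D \<le> 1" using card_mono[of "{\<one>\<^bsub>?GM\<^esub>}" ?D] by simp
    then have "p ^ 3 * card ?D \<le> p ^ 3" by simp
    then have "p ^ 4 \<le> p ^ 3" using M_large \<open>card M \<le> p ^ 3 * card ?D\<close> by linarith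
    then show False using power_strict_increasing[of 3 4 p] prime_gt_1_nat[OF p] by simp
  qed
  ultimately show ?thesis
    using i by (intro GM.has_irr_character_of_small_abelianization[OF p, of i])
      (simp_all add: Coset.order_def)
qed

theorem proposition6:
  fixes p :: nat and G :: "('a, 'b) monoid_scheme"
  assumes "Factorial_Ring.prime p"
    and "finite_p_group p G"
    and "Coset.order G \<ge> p ^ 5"
    and "subgroup_index G (commutator_subgroup G) \<le> p ^ 3"
  shows "(\<exists>\<^sub>\<le>\<^sub>1 H. maximal_subgroup H G \<and>
            \<not> has_irr_character_of_degree (G\<lparr>carrier := H\<rparr>) p) \<and>
         (\<forall>H. maximal_subgroup H G \<and> \<not> has_irr_character_of_degree (G\<lparr>carrier := H\<rparr>) p \<longrightarrow>
            (\<forall>M. maximal_subgroup M G \<and> M \<noteq> H \<longrightarrow>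
               subgroup_index (G\<lparr>carrier := M\<rparr>) (commutator_subgroup (G\<lparr>carrier := M\<rparr>))
                 \<le> subgroup_index G (commutator_subgroup G)))"
proof -
  interpret group G using assms(2) by (simp add: finite_p_group_def)
  obtain k where ord: "Coset.order G = p ^ k" using assms(2) by (auto simp: finite_p_group_def)
  have index: "subgroup_index (G\<lparr>carrier := M\<rparr>) (commutator_subgroup (G\<lparr>carrier := M\<rparr>))
      \<le> subgroup_index G (commutator_subgroup G)"
    if "maximal_subgroup H G" "\<not> has_irr_character_of_degree (G\<lparr>carrier := H\<rparr>) p"
      "maximal_subgroup M G" "M \<noteq> H" for H M
    using index_derived_of_exceptional[OF assms(1) ord that(1,3,4,2)] .
  have "M = H"
    if "maximal_subgroup H G" "\<not> has_irr_character_of_degree (G\<lparr>carrier := H\<rparr>) p"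
      "maximal_subgroup M G" "\<not> has_irr_character_of_degree (G\<lparr>carrier := M\<rparr>) p" for H M
  proof (rule ccontr)
    assume "M \<noteq> H"
    from index[OF that(1,2,3) this] assms(4)
    have "subgroup_index (G\<lparr>carrier := M\<rparr>) (commutator_subgroup (G\<lparr>carrier := M\<rparr>)) \<le> p ^ 3"
      by (rule le_trans)
    from maximal_subgroup_has_irr_character[OF assms(1) ord assms(3) that(3) this] that(4)
    show False by blast
  qed
  then show ?thesis using index by (auto intro!: Uniq_I)
qed

end
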